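(* Let $(\mathcal A,\mathfrak g)$ and $(\mathcal B,\mathfrak h)$ be constraint Lie-Rinehart algebras over a field $\Bbbk$. (i) The pair $(\mathcal A_{\mathrm{red}},\mathfrak g_{\mathrm{red}})$ together with the anchor $\rho_{\mathrm{red}}\colon\mathfrak g_{\mathrm{red}}\to\mathbf{C}\mathrm{Der}(\mathcal A)_{\mathrm{red}}\subseteq\mathrm{Der}(\mathcal A_{\mathrm{red}})$ is a Lie-Rinehart algebra. (ii) Let $(\phi,\Phi)\colon(\mathcal A,\mathfrak g)\to(\mathcal B,\mathfrak h)$ be a morphism of constraint Lie-Rinehart algebras. Then the pair of reduced morphisms $(\phi_{\mathrm{red}},\Phi_{\mathrm{red}})\colon(\mathcal A_{\mathrm{red}},\mathfrak g_{\mathrm{red}})\to(\mathcal B_{\mathrm{red}},\mathfrak h_{\mathrm{red}})$ is a morphism of Lie-Rinehart algebras. (iii) Mapping every constraint Lie-Rinehart algebra $(\mathcal A,\mathfrak g)$ to $(\mathcal A_{\mathrm{red}},\mathfrak g_{\mathrm{red}})$ and every morphism $(\phi,\Phi)$ of constraint Lie-Rinehart algebras to $(\phi_{\mathrm{red}},\Phi_{\mathrm{red}})$ defines a functor from the category of constraint Lie-Rinehart algebras to the category of Lie-Rinehart algebras.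
   Context: $\Bbbk$ is a field; algebras are associative and unital over $\Bbbk$. Constraint algebra: a triple $\mathcal A=(\mathcal A_{\mathrm T},\mathcal A_{\mathrm N},\mathcal A_0)$ with $\mathcal A_{\mathrm T}$ an algebra, $\mathcal A_{\mathrm N}\subseteq\mathcal A_{\mathrm T}$ a unital subalgebra, and $\mathcal A_0\subseteq\mathcal A_{\mathrm N}$ a two-sided ideal of $\mathcal A_{\mathrm N}$; it is commutative if $\mathcal A_{\mathrm T}$ is. Constraint $\mathcal A$-module: a triple $\mathcal E=(\mathcal E_{\mathrm T},\mathcal E_{\mathrm N},\mathcal E_0)$ with $\mathcal E_{\mathrm T}$ an $\mathcal A_{\mathrm T}$-module and $\mathcal A_{\mathrm N}$-submodules $\mathcal E_{\mathrm N}\subseteq\mathcal E_{\mathrm T}$ and $\mathcal E_0\subseteq\mathcal E_{\mathrm N}$. Constraint morphisms (of algebras, modules, Lie algebras) are morphisms of the $\mathrm T$-components mapping $\mathrm N$-components into $\mathrm N$-components and $0$-components into $0$-components. Reduction: $(\,\cdot\,)_{\mathrm{red}}=(\,\cdot\,)_{\mathrm N}/(\,\cdot\,)_0$ with the induced structures, where the reduction $\mathcal E_{\mathrm{red}}=\mathcal E_{\mathrm N}/\mathcal E_0$ of a constraint $\mathcal A$-module is regarded as an $\mathcal A_{\mathrm{red}}$-module; reduced morphisms are the induced maps. Constraint Lie algebra: a constraint $\Bbbk$-module $\mathfrak g$ (i.e. a vector space $\mathfrak g_{\mathrm T}$ with subspaces $\mathfrak g_0\subseteq\mathfrak g_{\mathrm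 N}\subseteq\mathfrak g_{\mathrm T}$) with a Lie bracket on $\mathfrak g_{\mathrm T}$ such that $[\mathfrak g_{\mathrm N},\mathfrak g_{\mathrm N}]\subseteq\mathfrak g_{\mathrm N}$ and $[\mathfrak g_{\mathrm N},\mathfrak g_0]\subseteq\mathfrak g_0$. Constraint derivations: $\mathbf{C}\mathrm{Der}(\mathcal A)_{\mathrm T}=\mathrm{Der}(\mathcal A_{\mathrm T})$; $\mathbf{C}\mathrm{Der}(\mathcal A)_{\mathrm N}=\{\delta\in\mathrm{Der}(\mathcal A_{\mathrm T}):\delta(\mathcal A_{\mathrm N})\subseteq\mathcal A_{\mathrm N},\ \delta(\mathcal A_0)\subseteq\mathcal A_0\}$; $\mathbf{C}\mathrm{Der}(\mathcal A)_0=\{\delta\in\mathrm{Der}(\mathcal A_{\mathrm T}):\delta(\mathcal A_{\mathrm N})\subseteq\mathcal A_0\}$. With the commutator this is a constraint Lie algebra, and there is a natural injection $\mathbf{C}\mathrm{Der}(\mathcal A)_{\mathrm{red}}\hookrightarrow\mathrm{Der}(\mathcal A_{\mathrm{red}})$. Constraint Lie-Rinehart algebra $(\mathcal A,\mathfrak g)$: a commutative constraint algebra $\mathcal A$, a constraint $\mathcal A$-module $\mathfrak g$ with a constraint Lie algebra structure $[\cdot,\cdot]$, and an anchor $\rho\colon\mathfrak g\to\mathbf{C}\mathrm{Der}(\mathcal A)$ which is a morphism of constraint Lie algebras and of constraint $\mathcal A$-modules, such that $[\xi,a\cdot\eta]=(\rho(\xi)a)\cdot\eta+a[\xi,\eta]$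 for all $\xi,\eta\in\mathfrak g_{\mathrm T}$, $a\in\mathcal A_{\mathrm T}$. Morphism $(\phi,\Phi)\colon(\mathcal A,\mathfrak g)\to(\mathcal B,\mathfrak h)$: a constraint Lie algebra morphism $\Phi\colon\mathfrak g\to\mathfrak h$ and a constraint algebra morphism $\phi\colon\mathcal A\to\mathcal B$ such that $\Phi$ is a morphism of constraint modules along $\phi$, i.e. $\Phi(a\xi)=\phi(a)\Phi(\xi)$, and $\rho_{\mathfrak h}(\Phi(\xi))\phi(a)=\phi(\rho_{\mathfrak g}(\xi)a)$ for $\xi\in\mathfrak g$, $a\in\mathcal A$. Classical Lie-Rinehart algebras and their morphisms are given by the same axioms without the $\mathrm N$- and $0$-components.
   Formalization: A constraint A-module E is additionally required to satisfy A_0·E_N ⊆ E_0; the listed definition omits this, and without it the induced A_red-module structure on E_red = E_N/E_0 is not well defined. *)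

theory Defs
  imports "HOL-Algebra.Module" "HOL-Algebra.QuotRing" "HOL-Algebra.Subrings"
begin

section \<open>Lie algebras and Lie-Rinehart algebras\<close>

text \<open>
  Algebraic structures are HOL-Algebra records with explicit carriers.  As usual for
  \<^typ>\<open>('a, 'b) module\<close>, the ring fields \<open>mult\<close> and \<open>one\<close> of a record that represents a
  mere module are irrelevant.  The locale \<^locale>\<open>algebra\<close> describes unital associative
  \<^emph>\<open>commutative\<close> algebras, the only ones that occur in Lie-Rinehart algebras.
\<close>

record ('r, 'v) lie_module = "('r, 'v) module" +
  lie_bracket :: "'v \<Rightarrow> 'v \<Rightarrow> 'v"

locale lie_algebra = module K L
  for K :: "('k, 'm) ring_scheme" (structure) and L :: "('k, 'v, 'n) lie_module_scheme" (structure) +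
  assumes bracket_closed:
      "\<lbrakk>x \<in> carrier L; y \<in> carrier L\<rbrakk> \<Longrightarrow> lie_bracket L x y \<in> carrier L"
    and bracket_add_left:
      "\<lbrakk>x \<in> carrier L; y \<in> carrier L; z \<in> carrier L\<rbrakk> \<Longrightarrow>
       lie_bracket L (x \<oplus>\<^bsub>L\<^esub> y) z = lie_bracket L x z \<oplus>\<^bsub>L\<^esub> lie_bracket L y z"
    and bracket_add_right:
      "\<lbrakk>x \<in> carrier L; y \<in> carrier L; z \<in> carrier L\<rbrakk> \<Longrightarrow>
       lie_bracket L x (y \<oplus>\<^bsub>L\<^esub> z) = lie_bracket L x y \<oplus>\<^bsub>L\<^esub> lie_bracket L x z"
    and bracket_smult_left:
      "\<lbrakk>c \<in> carrier K; x \<in> carrier L; y \<in> carrier L\<rbrakk> \<Longrightarrow>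
       lie_bracket L (c \<odot>\<^bsub>L\<^esub> x) y = c \<odot>\<^bsub>L\<^esub> lie_bracket L x y"
    and bracket_smult_right:
      "\<lbrakk>c \<in> carrier K; x \<in> carrier L; y \<in> carrier L\<rbrakk> \<Longrightarrow>
       lie_bracket L x (c \<odot>\<^bsub>L\<^esub> y) = c \<odot>\<^bsub>L\<^esub> lie_bracket L x y"
    and bracket_alternating:
      "x \<in> carrier L \<Longrightarrow> lie_bracket L x x = \<zero>\<^bsub>L\<^esub>"
    and jacobi:
      "\<lbrakk>x \<in> carrier L; y \<in> carrier L; z \<in> carrier L\<rbrakk> \<Longrightarrow>
       lie_bracket L x (lie_bracket L y z) \<oplus>\<^bsub>L\<^esub> lie_bracket L y (lie_bracket L z x)
         \<oplus>\<^bsub>L\<^esub> lie_bracket L z (lie_bracket L x y) = \<zero>\<^bsub>L\<^esub>"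

definition module_hom ::
  "('r, 'm) ring_scheme \<Rightarrow> ('r, 'v, 'n) module_scheme \<Rightarrow> ('r, 'w, 'o) module_scheme \<Rightarrow> ('v \<Rightarrow> 'w) set"
  where "module_hom R M N =
    {f \<in> carrier M \<rightarrow> carrier N.
       (\<forall>x\<in>carrier M. \<forall>y\<in>carrier M. f (x \<oplus>\<^bsub>M\<^esub> y) = f x \<oplus>\<^bsub>N\<^esub> f y) \<and>
       (\<forall>r\<in>carrier R. \<forall>x\<in>carrier M. f (r \<odot>\<^bsub>M\<^esub> x) = r \<odot>\<^bsub>N\<^esub> f x)}"

definition algebra_hom ::
  "('k, 'm) ring_scheme \<Rightarrow> ('k, 'a, 'n) module_scheme \<Rightarrow> ('k, 'b, 'o) module_scheme \<Rightarrow> ('a \<Rightarrow> 'b) set"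
  where "algebra_hom K A B = ring_hom A B \<inter> module_hom K A B"

definition lie_hom ::
  "('k, 'm) ring_scheme \<Rightarrow> ('k, 'v, 'n) lie_module_scheme \<Rightarrow> ('k, 'w, 'o) lie_module_scheme \<Rightarrow> ('v \<Rightarrow> 'w) set"
  where "lie_hom K L M =
    {f \<in> module_hom K L M.
       \<forall>x\<in>carrier L. \<forall>y\<in>carrier L. f (lie_bracket L x y) = lie_bracket M (f x) (f y)}"

text \<open>The \<open>K\<close>-module structure of an \<open>A\<close>-module, along the unit map \<open>c \<mapsto> c \<cdot> 1\<close> of the \<open>K\<close>-algebra \<open>A\<close>.\<close>

definition restrict_scalars ::
  "('k, 'a, 'm) module_scheme \<Rightarrow> ('a, 'v) lie_module \<Rightarrow> ('k, 'v) lie_module"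
  where "restrict_scalars A L =
    \<lparr>carrier = carrier L, mult = mult L, one = one L, zero = zero L, add = add L,
     smult = (\<lambda>c x. (c \<odot>\<^bsub>A\<^esub> \<one>\<^bsub>A\<^esub>) \<odot>\<^bsub>L\<^esub> x), lie_bracket = lie_bracket L\<rparr>"

text \<open>
  The \<open>A\<close>-module and Lie algebra \<open>Der(A)\<close> of \<open>K\<close>-linear derivations.  Maps are extensional
  (\<open>undefined\<close> off the carrier), so that equality of derivations is equality of functions.
\<close>

definition Der ::
  "('k, 'm) ring_scheme \<Rightarrow> ('k, 'a, 'n) module_scheme \<Rightarrow> ('a, 'a \<Rightarrow> 'a) lie_module"
  where "Der K A =
    \<lparr>carrier = {\<delta> \<in> module_hom K A A \<inter> extensional (carrier A).
        \<forall>a\<in>carrier A. \<forall>b\<in>carrier A. \<delta> (a \<otimes>\<^bsub>A\<^esub> b) = \<delta> a \<otimes>\<^bsub>A\<^esub> b \<oplus>\<^bsub>A\<^esub> a \<otimes>\<^bsub>A\<^esub> \<delta> b},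
     mult = undefined, one = undefined,
     zero = (\<lambda>a\<in>carrier A. \<zero>\<^bsub>A\<^esub>),
     add = (\<lambda>\<delta> \<epsilon>. \<lambda>a\<in>carrier A. \<delta> a \<oplus>\<^bsub>A\<^esub> \<epsilon> a),
     smult = (\<lambda>b \<delta>. \<lambda>a\<in>carrier A. b \<otimes>\<^bsub>A\<^esub> \<delta> a),
     lie_bracket = (\<lambda>\<delta> \<epsilon>. \<lambda>a\<in>carrier A. \<delta> (\<epsilon> a) \<ominus>\<^bsub>A\<^esub> \<epsilon> (\<delta> a))\<rparr>"

record ('k, 'a, 'g) lie_rinehart_data =
  lr_alg :: "('k, 'a) module"
  lr_lie :: "('a, 'g) lie_module"
  lr_anchor :: "'g \<Rightarrow> 'a \<Rightarrow> 'a"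

locale lie_rinehart =
  fixes K :: "('k, 'm) ring_scheme" and X :: "('k, 'a, 'g) lie_rinehart_data"
  assumes alg: "algebra K (lr_alg X)"
    and mod: "module (lr_alg X) (lr_lie X)"
    and lie: "lie_algebra K (restrict_scalars (lr_alg X) (lr_lie X))"
    and anchor_lie_hom:
      "lr_anchor X \<in> lie_hom K (restrict_scalars (lr_alg X) (lr_lie X))
                               (restrict_scalars (lr_alg X) (Der K (lr_alg X)))"
    and anchor_module_hom:
      "lr_anchor X \<in> module_hom (lr_alg X) (lr_lie X) (Der K (lr_alg X))"
    and leibniz:
      "\<lbrakk>\<xi> \<in> carrier (lr_lie X); \<eta> \<in> carrier (lr_lie X); a \<in> carrier (lr_alg X)\<rbrakk> \<Longrightarrow>
       lie_bracket (lr_lie X) \<xi> (a \<odot>\<^bsub>lr_lie X\<^esub> \<eta>) =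
         (lr_anchor X \<xi> a \<odot>\<^bsub>lr_lie X\<^esub> \<eta>) \<oplus>\<^bsub>lr_lie X\<^esub> (a \<odot>\<^bsub>lr_lie X\<^esub> lie_bracket (lr_lie X) \<xi> \<eta>)"

definition lie_rinehart_hom ::
  "('k, 'm) ring_scheme \<Rightarrow> ('k, 'a, 'g) lie_rinehart_data \<Rightarrow> ('k, 'b, 'h) lie_rinehart_data
    \<Rightarrow> (('a \<Rightarrow> 'b) \<times> ('g \<Rightarrow> 'h)) set"
  where "lie_rinehart_hom K X Y =
    {(\<phi>, \<Phi>).
       \<phi> \<in> algebra_hom K (lr_alg X) (lr_alg Y) \<inter> extensional (carrier (lr_alg X)) \<and>
       \<Phi> \<in> lie_hom K (restrict_scalars (lr_alg X) (lr_lie X)) (restrict_scalars (lr_alg Y) (lr_lie Y))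
           \<inter> extensional (carrier (lr_lie X)) \<and>
       (\<forall>a\<in>carrier (lr_alg X). \<forall>\<xi>\<in>carrier (lr_lie X).
          \<Phi> (a \<odot>\<^bsub>lr_lie X\<^esub> \<xi>) = \<phi> a \<odot>\<^bsub>lr_lie Y\<^esub> \<Phi> \<xi>) \<and>
       (\<forall>a\<in>carrier (lr_alg X). \<forall>\<xi>\<in>carrier (lr_lie X).
          lr_anchor Y (\<Phi> \<xi>) (\<phi> a) = \<phi> (lr_anchor X \<xi> a))}"


section \<open>Constraint structures\<close>

record ('s, 'a) constraint =
  comp_T :: 's
  comp_N :: "'a set"
  comp_0 :: "'a set"

definition constraint_maps :: "('s, 'a) constraint \<Rightarrow> ('t, 'b) constraint \<Rightarrow> ('a \<Rightarrow> 'b) set"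
  where "constraint_maps C D = {f. f ` comp_N C \<subseteq> comp_N D \<and> f ` comp_0 C \<subseteq> comp_0 D}"

locale comm_constraint_algebra =
  fixes K :: "('k, 'm) ring_scheme" and A :: "(('k, 'a) module, 'a) constraint"
  assumes T_algebra: "algebra K (comp_T A)"
    and N_subring: "subring (comp_N A) (comp_T A)"
    and N_submodule: "submodule (comp_N A) K (comp_T A)"
    and zero_ideal: "ideal (comp_0 A) ((comp_T A)\<lparr>carrier := comp_N A\<rparr>)"

text \<open>
  The condition \<open>zero_smult\<close>, that is \<open>A\<^sub>0 E\<^sub>N \<subseteq> E\<^sub>0\<close>, is what makes \<open>E\<^sub>N / E\<^sub>0\<close> a module over
  \<open>A\<^sub>N / A\<^sub>0\<close> (and not only over \<open>A\<^sub>N\<close>).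
\<close>

locale constraint_module =
  fixes A :: "(('k, 'a, 'm) module_scheme, 'a) constraint"
    and E :: "(('a, 'e, 'n) module_scheme, 'e) constraint"
  assumes T_module: "module (comp_T A) (comp_T E)"
    and N_submodule: "submodule (comp_N E) ((comp_T A)\<lparr>carrier := comp_N A\<rparr>) (comp_T E)"
    and zero_submodule: "submodule (comp_0 E) ((comp_T A)\<lparr>carrier := comp_N A\<rparr>) (comp_T E)"
    and zero_subset: "comp_0 E \<subseteq> comp_N E"
    and zero_smult: "\<lbrakk>a \<in> comp_0 A; x \<in> comp_N E\<rbrakk> \<Longrightarrow> a \<odot>\<^bsub>comp_T E\<^esub> x \<in> comp_0 E"

locale constraint_lie_algebra =
  fixes K :: "('k, 'm) ring_scheme" and L :: "(('k, 'v) lie_module, 'v) constraint"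
  assumes T_lie_algebra: "lie_algebra K (comp_T L)"
    and N_subspace: "submodule (comp_N L) K (comp_T L)"
    and zero_subspace: "submodule (comp_0 L) K (comp_T L)"
    and zero_subset: "comp_0 L \<subseteq> comp_N L"
    and bracket_N_N:
      "\<lbrakk>x \<in> comp_N L; y \<in> comp_N L\<rbrakk> \<Longrightarrow> lie_bracket (comp_T L) x y \<in> comp_N L"
    and bracket_N_zero:
      "\<lbrakk>x \<in> comp_N L; y \<in> comp_0 L\<rbrakk> \<Longrightarrow> lie_bracket (comp_T L) x y \<in> comp_0 L"

definition constraint_restrict_scalars ::
  "(('k, 'a, 'm) module_scheme, 'a) constraint \<Rightarrow> (('a, 'v) lie_module, 'v) constraint
    \<Rightarrow> (('k, 'v) lie_module, 'v) constraint"
  where "constraint_restrict_scalars A L =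
    \<lparr>comp_T = restrict_scalars (comp_T A) (comp_T L), comp_N = comp_N L, comp_0 = comp_0 L\<rparr>"

definition CDer ::
  "('k, 'm) ring_scheme \<Rightarrow> (('k, 'a) module, 'a) constraint
    \<Rightarrow> (('a, 'a \<Rightarrow> 'a) lie_module, 'a \<Rightarrow> 'a) constraint"
  where "CDer K A =
    \<lparr>comp_T = Der K (comp_T A),
     comp_N = {\<delta> \<in> carrier (Der K (comp_T A)).
                 \<delta> ` comp_N A \<subseteq> comp_N A \<and> \<delta> ` comp_0 A \<subseteq> comp_0 A},
     comp_0 = {\<delta> \<in> carrier (Der K (comp_T A)). \<delta> ` comp_N A \<subseteq> comp_0 A}\<rparr>"

definition constraint_module_hom ::
  "(('r, 'a, 'm) module_scheme, 'a) constraint \<Rightarrow> (('a, 'v, 'n) module_scheme, 'v) constraint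
    \<Rightarrow> (('a, 'w, 'o) module_scheme, 'w) constraint \<Rightarrow> ('v \<Rightarrow> 'w) set"
  where "constraint_module_hom A E F =
    module_hom (comp_T A) (comp_T E) (comp_T F) \<inter> constraint_maps E F"

definition constraint_algebra_hom ::
  "('k, 'm) ring_scheme \<Rightarrow> (('k, 'a) module, 'a) constraint \<Rightarrow> (('k, 'b) module, 'b) constraint
    \<Rightarrow> ('a \<Rightarrow> 'b) set"
  where "constraint_algebra_hom K A B =
    algebra_hom K (comp_T A) (comp_T B) \<inter> constraint_maps A B"

definition constraint_lie_hom ::
  "('k, 'm) ring_scheme \<Rightarrow> (('k, 'v) lie_module, 'v) constraint \<Rightarrow> (('k, 'w) lie_module, 'w) constraint
    \<Rightarrow> ('v \<Rightarrow> 'w) set"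
  where "constraint_lie_hom K L M = lie_hom K (comp_T L) (comp_T M) \<inter> constraint_maps L M"

record ('k, 'a, 'g) constraint_lie_rinehart_data =
  clr_alg :: "(('k, 'a) module, 'a) constraint"
  clr_lie :: "(('a, 'g) lie_module, 'g) constraint"
  clr_anchor :: "'g \<Rightarrow> 'a \<Rightarrow> 'a"

locale constraint_lie_rinehart =
  fixes K :: "('k, 'm) ring_scheme" and X :: "('k, 'a, 'g) constraint_lie_rinehart_data"
  assumes alg: "comm_constraint_algebra K (clr_alg X)"
    and mod: "constraint_module (clr_alg X) (clr_lie X)"
    and lie: "constraint_lie_algebra K (constraint_restrict_scalars (clr_alg X) (clr_lie X))"
    and anchor_lie_hom:
      "clr_anchor X \<in> constraint_lie_hom K
         (constraint_restrict_scalars (clr_alg X) (clr_lie X))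
         (constraint_restrict_scalars (clr_alg X) (CDer K (clr_alg X)))"
    and anchor_module_hom:
      "clr_anchor X \<in> constraint_module_hom (clr_alg X) (clr_lie X) (CDer K (clr_alg X))"
    and leibniz:
      "\<lbrakk>\<xi> \<in> carrier (comp_T (clr_lie X)); \<eta> \<in> carrier (comp_T (clr_lie X));
        a \<in> carrier (comp_T (clr_alg X))\<rbrakk> \<Longrightarrow>
       lie_bracket (comp_T (clr_lie X)) \<xi> (a \<odot>\<^bsub>comp_T (clr_lie X)\<^esub> \<eta>) =
         (clr_anchor X \<xi> a \<odot>\<^bsub>comp_T (clr_lie X)\<^esub> \<eta>) \<oplus>\<^bsub>comp_T (clr_lie X)\<^esub>
         (a \<odot>\<^bsub>comp_T (clr_lie X)\<^esub> lie_bracket (comp_T (clr_lie X)) \<xi> \<eta>)"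

definition constraint_lie_rinehart_hom ::
  "('k, 'm) ring_scheme \<Rightarrow> ('k, 'a, 'g) constraint_lie_rinehart_data
    \<Rightarrow> ('k, 'b, 'h) constraint_lie_rinehart_data \<Rightarrow> (('a \<Rightarrow> 'b) \<times> ('g \<Rightarrow> 'h)) set"
  where "constraint_lie_rinehart_hom K X Y =
    {(\<phi>, \<Phi>).
       \<phi> \<in> constraint_algebra_hom K (clr_alg X) (clr_alg Y)
           \<inter> extensional (carrier (comp_T (clr_alg X))) \<and>
       \<Phi> \<in> constraint_lie_hom K (constraint_restrict_scalars (clr_alg X) (clr_lie X))
                                 (constraint_restrict_scalars (clr_alg Y) (clr_lie Y))
           \<inter> extensional (carrier (comp_T (clr_lie X))) \<and>
       (\<forall>a\<in>carrier (comp_T (clr_alg X)). \<forall>\<xi>\<in>carrier (comp_T (clr_lie X)).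
          \<Phi> (a \<odot>\<^bsub>comp_T (clr_lie X)\<^esub> \<xi>) = \<phi> a \<odot>\<^bsub>comp_T (clr_lie Y)\<^esub> \<Phi> \<xi>) \<and>
       (\<forall>a\<in>carrier (comp_T (clr_alg X)). \<forall>\<xi>\<in>carrier (comp_T (clr_lie X)).
          clr_anchor Y (\<Phi> \<xi>) (\<phi> a) = \<phi> (clr_anchor X \<xi> a))}"


section \<open>Reduction\<close>

text \<open>
  Elements of \<open>E\<^sub>N / E\<^sub>0\<close> are cosets.  As for \<^const>\<open>rcoset_mult\<close>, every induced operation or map is
  the union, over all representatives, of the cosets of the results; it is a single coset
  exactly if the operation does not depend on the representatives.
\<close>

definition red_carrier :: "(('r, 'v, 'm) module_scheme, 'v) constraint \<Rightarrow> 'v set set"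
  where "red_carrier C = a_rcosets\<^bsub>(comp_T C)\<lparr>carrier := comp_N C\<rparr>\<^esub> (comp_0 C)"

definition red_map ::
  "(('r, 'v, 'm) module_scheme, 'v) constraint \<Rightarrow> (('s, 'w, 'n) module_scheme, 'w) constraint
    \<Rightarrow> ('v \<Rightarrow> 'w) \<Rightarrow> 'v set \<Rightarrow> 'w set"
  where "red_map C D f = (\<lambda>P\<in>red_carrier C. \<Union>x\<in>P. comp_0 D +>\<^bsub>comp_T D\<^esub> f x)"

definition red_algebra :: "(('k, 'a) module, 'a) constraint \<Rightarrow> ('k, 'a set) module"
  where "red_algebra A =
    (let Q = (comp_T A)\<lparr>carrier := comp_N A\<rparr> Quot comp_0 A in
     \<lparr>carrier = carrier Q, mult = mult Q, one = one Q, zero = zero Q, add = add Q,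
      smult = (\<lambda>c P. \<Union>a\<in>P. comp_0 A +>\<^bsub>comp_T A\<^esub> (c \<odot>\<^bsub>comp_T A\<^esub> a))\<rparr>)"

definition red_lie_module :: "(('a, 'v) lie_module, 'v) constraint \<Rightarrow> ('a set, 'v set) lie_module"
  where "red_lie_module E =
    \<lparr>carrier = red_carrier E, mult = undefined, one = undefined,
     zero = comp_0 E, add = set_add (comp_T E),
     smult = (\<lambda>P Q. \<Union>a\<in>P. \<Union>x\<in>Q. comp_0 E +>\<^bsub>comp_T E\<^esub> (a \<odot>\<^bsub>comp_T E\<^esub> x)),
     lie_bracket = (\<lambda>P Q. \<Union>x\<in>P. \<Union>y\<in>Q. comp_0 E +>\<^bsub>comp_T E\<^esub> lie_bracket (comp_T E) x y)\<rparr>"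

text \<open>The injection of \<open>CDer(A)\<^sub>r\<^sub>e\<^sub>d\<close> into \<open>Der(A\<^sub>r\<^sub>e\<^sub>d)\<close>, mapping \<open>[\<delta>]\<close> to \<open>[a] \<mapsto> [\<delta> a]\<close>.\<close>

definition red_der_embed ::
  "(('k, 'a) module, 'a) constraint \<Rightarrow> ('a \<Rightarrow> 'a) set \<Rightarrow> 'a set \<Rightarrow> 'a set"
  where "red_der_embed A \<Delta> = (\<lambda>P\<in>red_carrier A. \<Union>\<delta>\<in>\<Delta>. \<Union>a\<in>P. comp_0 A +>\<^bsub>comp_T A\<^esub> \<delta> a)"

definition red_lie_rinehart ::
  "('k, 'm) ring_scheme \<Rightarrow> ('k, 'a, 'g) constraint_lie_rinehart_data
    \<Rightarrow> ('k, 'a set, 'g set) lie_rinehart_data"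
  where "red_lie_rinehart K X =
    \<lparr>lr_alg = red_algebra (clr_alg X),
     lr_lie = red_lie_module (clr_lie X),
     lr_anchor = (\<lambda>P. red_der_embed (clr_alg X)
                    (red_map (clr_lie X) (CDer K (clr_alg X)) (clr_anchor X) P))\<rparr>"

definition red_lie_rinehart_hom ::
  "('k, 'a, 'g) constraint_lie_rinehart_data \<Rightarrow> ('k, 'b, 'h) constraint_lie_rinehart_data
    \<Rightarrow> ('a \<Rightarrow> 'b) \<times> ('g \<Rightarrow> 'h) \<Rightarrow> ('a set \<Rightarrow> 'b set) \<times> ('g set \<Rightarrow> 'h set)"
  where "red_lie_rinehart_hom X Y =
    (\<lambda>(\<phi>, \<Phi>). (red_map (clr_alg X) (clr_alg Y) \<phi>, red_map (clr_lie X) (clr_lie Y) \<Phi>))"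


section \<open>Categories and functors\<close>

text \<open>Hom-sets are indexed by objects and need not be disjoint; hence composition takes the three objects.\<close>

record ('o, 'm) category =
  Obj :: "'o set"
  Hom :: "'o \<Rightarrow> 'o \<Rightarrow> 'm set"
  Ident :: "'o \<Rightarrow> 'm"
  Comp :: "'o \<Rightarrow> 'o \<Rightarrow> 'o \<Rightarrow> 'm \<Rightarrow> 'm \<Rightarrow> 'm"

locale category =
  fixes C :: "('o, 'm) category"
  assumes Ident_in_Hom: "X \<in> Obj C \<Longrightarrow> Ident C X \<in> Hom C X X"
    and Comp_in_Hom:
      "\<lbrakk>X \<in> Obj C; Y \<in> Obj C; Z \<in> Obj C; f \<in> Hom C X Y; g \<in> Hom C Y Z\<rbrakk> \<Longrightarrow>
       Comp C X Y Z g f \<in> Hom C X Z"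
    and Comp_Ident_right:
      "\<lbrakk>X \<in> Obj C; Y \<in> Obj C; f \<in> Hom C X Y\<rbrakk> \<Longrightarrow> Comp C X X Y f (Ident C X) = f"
    and Comp_Ident_left:
      "\<lbrakk>X \<in> Obj C; Y \<in> Obj C; f \<in> Hom C X Y\<rbrakk> \<Longrightarrow> Comp C X Y Y (Ident C Y) f = f"
    and Comp_assoc:
      "\<lbrakk>W \<in> Obj C; X \<in> Obj C; Y \<in> Obj C; Z \<in> Obj C;
        f \<in> Hom C W X; g \<in> Hom C X Y; h \<in> Hom C Y Z\<rbrakk> \<Longrightarrow>
       Comp C W Y Z h (Comp C W X Y g f) = Comp C W X Z (Comp C X Y Z h g) f"

locale category_functor = C: category C + D: category D
  for C :: "('o, 'm) category" and D :: "('p, 'n) category" +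
  fixes F_obj :: "'o \<Rightarrow> 'p" and F_hom :: "'o \<Rightarrow> 'o \<Rightarrow> 'm \<Rightarrow> 'n"
  assumes F_obj: "X \<in> Obj C \<Longrightarrow> F_obj X \<in> Obj D"
    and F_hom:
      "\<lbrakk>X \<in> Obj C; Y \<in> Obj C; f \<in> Hom C X Y\<rbrakk> \<Longrightarrow> F_hom X Y f \<in> Hom D (F_obj X) (F_obj Y)"
    and F_Ident: "X \<in> Obj C \<Longrightarrow> F_hom X X (Ident C X) = Ident D (F_obj X)"
    and F_Comp:
      "\<lbrakk>X \<in> Obj C; Y \<in> Obj C; Z \<in> Obj C; f \<in> Hom C X Y; g \<in> Hom C Y Z\<rbrakk> \<Longrightarrow>
       F_hom X Z (Comp C X Y Z g f) =
         Comp D (F_obj X) (F_obj Y) (F_obj Z) (F_hom Y Z g) (F_hom X Y f)"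

text \<open>
  The types of elements play the role of the universe: objects are all (constraint) Lie-Rinehart
  algebras over \<open>K\<close> with algebra carried by a subset of \<open>'a\<close> and module by a subset of \<open>'g\<close>.
\<close>

definition LieRinehart_cat ::
  "('k, 'm) ring_scheme
    \<Rightarrow> (('k, 'a, 'g) lie_rinehart_data, ('a \<Rightarrow> 'a) \<times> ('g \<Rightarrow> 'g)) category"
  where "LieRinehart_cat K =
    \<lparr>Obj = {X. lie_rinehart K X},
     Hom = lie_rinehart_hom K,
     Ident = (\<lambda>X. (\<lambda>a\<in>carrier (lr_alg X). a, \<lambda>\<xi>\<in>carrier (lr_lie X). \<xi>)),
     Comp = (\<lambda>X Y Z (\<psi>, \<Psi>) (\<phi>, \<Phi>).
       (compose (carrier (lr_alg X)) \<psi> \<phi>, compose (carrier (lr_lie X)) \<Psi> \<Phi>))\<rparr>"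

definition CLieRinehart_cat ::
  "('k, 'm) ring_scheme
    \<Rightarrow> (('k, 'a, 'g) constraint_lie_rinehart_data, ('a \<Rightarrow> 'a) \<times> ('g \<Rightarrow> 'g)) category"
  where "CLieRinehart_cat K =
    \<lparr>Obj = {X. constraint_lie_rinehart K X},
     Hom = constraint_lie_rinehart_hom K,
     Ident = (\<lambda>X. (\<lambda>a\<in>carrier (comp_T (clr_alg X)). a, \<lambda>\<xi>\<in>carrier (comp_T (clr_lie X)). \<xi>)),
     Comp = (\<lambda>X Y Z (\<psi>, \<Psi>) (\<phi>, \<Phi>).
       (compose (carrier (comp_T (clr_alg X))) \<psi> \<phi>,
        compose (carrier (comp_T (clr_lie X))) \<Psi> \<Phi>))\<rparr>"

end

theory Submission
  imports Defs
begin

text \<open>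
  Every operation of a constraint Lie-Rinehart algebra that is used on the \<open>N\<close>-components is
  additive in each argument and maps into the \<open>0\<close>-component as soon as one argument lies there.
  Hence it is compatible with the cosets of the \<open>0\<close>-components, and the union of cosets that
  defines the reduced operation is the single coset of the value at any pair of representatives.
  All identities in \<open>(A\<^sub>r\<^sub>e\<^sub>d, g\<^sub>r\<^sub>e\<^sub>d)\<close>, the morphism laws and functoriality are then read off on
  representatives.  For the anchor this needs \<open>CDer(A)\<^sub>0\<close> to be an additive subgroup of
  \<open>CDer(A)\<^sub>N\<close>, since the reduced anchor is computed through cosets of derivations.
\<close>

section \<open>Residue classes\<close>

text \<open>For x in \<open>comp_N C\<close> this is the class of x in the reduction. The coset sees
  only the addition of \<open>comp_T C\<close>, so one notation serves algebras, modules and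
  \<open>CDer\<close>.\<close>

definition residue :: "(('r, 'v, 'm) module_scheme, 'v) constraint \<Rightarrow> 'v \<Rightarrow> 'v set"
  where "residue C x = comp_0 C +>\<^bsub>comp_T C\<^esub> x"

text \<open>The additive core shared by constraint algebras, constraint modules and
  \<open>CDer\<close>, so that all coset calculations are done once.\<close>

locale constraint_group = T: abelian_group "comp_T C"
  for C :: "(('r, 'v, 'm) module_scheme, 'v) constraint" +
  assumes N_subgroup: "additive_subgroup (comp_N C) (comp_T C)"
    and zero_subgroup: "additive_subgroup (comp_0 C) (comp_T C)"
    and zero_subset_N: "comp_0 C \<subseteq> comp_N C"
begin

sublocale N: additive_subgroup "comp_N C" "comp_T C"
  by (rule N_subgroup)

sublocale zero: abelian_subgroup "comp_0 C" "comp_T C"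
  by (rule abelian_subgroupI3[OF zero_subgroup T.abelian_group_axioms])

lemma N_carrier [simp]: "x \<in> comp_N C \<Longrightarrow> x \<in> carrier (comp_T C)"
  by (rule N.a_Hcarr)

lemma zero_N [simp]: "x \<in> comp_0 C \<Longrightarrow> x \<in> comp_N C"
  using zero_subset_N by blast

text \<open>Restricting the carrier to \<open>comp_N C\<close> limits the representatives but does
  not change their cosets. Rewriting with this turns a quantifier over classes into one over
  representatives.\<close>

lemma red_carrier_eq: "red_carrier C = residue C ` comp_N C"
  by (auto simp: red_carrier_def residue_def A_RCOSETS_def' a_r_coset_def')

lemma residue_in_red_carrier [simp]: "x \<in> comp_N C \<Longrightarrow> residue C x \<in> red_carrier C"
  by (simp add: red_carrier_eq)

lemma residue_self: "x \<in> comp_N C \<Longrightarrow> x \<in> residue C x"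
  by (simp add: residue_def zero.a_rcos_self)

lemma residueE:
  assumes "y \<in> residue C x" "x \<in> comp_N C"
  obtains z where "z \<in> comp_0 C" "y = z \<oplus>\<^bsub>comp_T C\<^esub> x"
  using assms by (auto simp: residue_def a_r_coset_def')

text \<open>Changing a representative alters a value by a summand in \<open>comp_0 C\<close>. This
  rule discards that summand in the later proofs of well-definedness.\<close>

lemma residue_absorb:
  assumes "z \<in> comp_0 C" "x \<in> comp_N C"
  shows "residue C (z \<oplus>\<^bsub>comp_T C\<^esub> x) = residue C x"
proof -
  have "z \<oplus>\<^bsub>comp_T C\<^esub> x \<in> comp_0 C +>\<^bsub>comp_T C\<^esub> x"
    using assms by (auto simp: a_r_coset_def')
  then show ?thesis
    unfolding residue_def
    using assms(2) by (metis T.a_repr_independence N_carrier zero_subgroup additive_subgroup.a_subgroup)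
qed

lemma residue_zero: "residue C \<zero>\<^bsub>comp_T C\<^esub> = comp_0 C"
  by (simp add: residue_def zero.a_subset)

lemma set_add_residue [simp]:
  "\<lbrakk>x \<in> comp_N C; y \<in> comp_N C\<rbrakk> \<Longrightarrow>
    residue C x <+>\<^bsub>comp_T C\<^esub> residue C y = residue C (x \<oplus>\<^bsub>comp_T C\<^esub> y)"
  by (simp add: residue_def zero.a_rcos_sum)

text \<open>Invariance under shifts by \<open>comp_0 C\<close> makes \<open>g\<close> constant on
  the coset, and the coset contains \<open>a\<close>, so the union is neither empty nor larger than
  \<open>g a\<close>.\<close>

lemma UN_residue:
  assumes a: "a \<in> comp_N C" and "\<And>z. z \<in> comp_0 C \<Longrightarrow> g (z \<oplus>\<^bsub>comp_T C\<^esub> a) = g a"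
  shows "(\<Union>x\<in>residue C a. g x) = g a"
proof -
  have "g x = g a" if "x \<in> residue C a" for x
    using that a assms(2) by (elim residueE) auto
  then show ?thesis
    using residue_self[OF a] by blast
qed

text \<open>Leaving \<open>Q\<close> arbitrary up to these three fields lets one proof cover both
  \<open>red_algebra\<close> and \<open>red_lie_module\<close>. The inverse of a class is the class
  of the negative.\<close>

lemma abelian_group_red:
  assumes carrier: "carrier Q = red_carrier C" and zero: "zero Q = comp_0 C"
    and add: "add Q = set_add (comp_T C)"
  shows "abelian_group Q"
proof -
  have zero': "zero Q = residue C \<zero>\<^bsub>comp_T C\<^esub>"
    by (simp add: zero residue_zero)
  have "\<exists>y\<in>carrier Q. y \<oplus>\<^bsub>Q\<^esub> x = \<zero>\<^bsub>Q\<^esub>" if "x \<in> carrier Q" for x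
  proof -
    obtain u where "u \<in> comp_N C" "x = residue C u"
      using \<open>x \<in> carrier Q\<close> by (auto simp: carrier red_carrier_eq)
    then show ?thesis
      by (intro bexI[of _ "residue C (\<ominus>\<^bsub>comp_T C\<^esub> u)"])
        (simp_all add: carrier add zero' T.l_neg)
  qed
  then show ?thesis
    by (intro abelian_groupI)
      (auto simp: carrier red_carrier_eq zero' add T.a_ac)
qed

end

text \<open>A shift of either argument by a 0-element adds a value in \<open>comp_0 E\<close>, which
  the residue absorbs. Three separate constraint groups are allowed because the rule is applied to
  ring multiplication, module action, Lie bracket and evaluation of derivations.\<close>

lemma UN_residue_biadditive:
  assumes "constraint_group C" "constraint_group D" "constraint_group E"
    and closed: "\<And>x y. \<lbrakk>x \<in> comp_N C; y \<in> comp_N D\<rbrakk> \<Longrightarrow> f x y \<in> comp_N E"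
    and add_left: "\<And>x x' y. \<lbrakk>x \<in> comp_N C; x' \<in> comp_N C; y \<in> comp_N D\<rbrakk> \<Longrightarrow>
      f (x \<oplus>\<^bsub>comp_T C\<^esub> x') y = f x y \<oplus>\<^bsub>comp_T E\<^esub> f x' y"
    and add_right: "\<And>x y y'. \<lbrakk>x \<in> comp_N C; y \<in> comp_N D; y' \<in> comp_N D\<rbrakk> \<Longrightarrow>
      f x (y \<oplus>\<^bsub>comp_T D\<^esub> y') = f x y \<oplus>\<^bsub>comp_T E\<^esub> f x y'"
    and zero_left: "\<And>x y. \<lbrakk>x \<in> comp_0 C; y \<in> comp_N D\<rbrakk> \<Longrightarrow> f x y \<in> comp_0 E"
    and zero_right: "\<And>x y. \<lbrakk>x \<in> comp_N C; y \<in> comp_0 D\<rbrakk> \<Longrightarrow> f x y \<in> comp_0 E"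
    and x: "x \<in> comp_N C" and y: "y \<in> comp_N D"
  shows "(\<Union>u\<in>residue C x. \<Union>v\<in>residue D y. residue E (f u v)) = residue E (f x y)"
proof -
  interpret C: constraint_group C by fact
  interpret D: constraint_group D by fact
  interpret E: constraint_group E by fact
  \<comment> \<open>The unions are collapsed from the inside: once the second argument is fixed at
    \<open>y\<close>, a shift of the first one can be absorbed.\<close>
  have inner: "(\<Union>v\<in>residue D y. residue E (f u v)) = residue E (f u y)" if "u \<in> comp_N C" for u
    using that y by (intro D.UN_residue) (simp_all add: add_right zero_right closed E.residue_absorb)
  have "(\<Union>v\<in>residue D y. residue E (f (z \<oplus>\<^bsub>comp_T C\<^esub> x) v)) = (\<Union>v\<in>residue D y. residue E (f x v))"
    if "z \<in> comp_0 C" for z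
    using that x y by (simp add: inner add_left zero_left closed E.residue_absorb)
  with x have "(\<Union>u\<in>residue C x. \<Union>v\<in>residue D y. residue E (f u v))
      = (\<Union>v\<in>residue D y. residue E (f x v))"
    by (rule C.UN_residue)
  then show ?thesis
    using x by (simp add: inner)
qed

lemma red_map_extensional: "red_map C D f \<in> extensional (red_carrier C)"
  by (simp add: red_map_def)

lemma (in constraint_group) red_map_eqI:
  assumes "g \<in> extensional (red_carrier C)"
    and "\<And>x. x \<in> comp_N C \<Longrightarrow> red_map C D f (residue C x) = g (residue C x)"
  shows "red_map C D f = g"
  by (rule extensionalityI[OF red_map_extensional assms(1)]) (auto simp: red_carrier_eq assms(2))

text \<open>Additivity is asked for on \<open>comp_N C\<close> only; the rule applies to the anchor
  as a map into \<open>CDer\<close> as well as to both components of a morphism.\<close>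

lemma red_map_residue:
  assumes "constraint_group C" "constraint_group D"
    and closed: "\<And>x. x \<in> comp_N C \<Longrightarrow> f x \<in> comp_N D"
    and zero: "\<And>x. x \<in> comp_0 C \<Longrightarrow> f x \<in> comp_0 D"
    and add: "\<And>x y. \<lbrakk>x \<in> comp_N C; y \<in> comp_N C\<rbrakk> \<Longrightarrow>
      f (x \<oplus>\<^bsub>comp_T C\<^esub> y) = f x \<oplus>\<^bsub>comp_T D\<^esub> f y"
    and x: "x \<in> comp_N C"
  shows "red_map C D f (residue C x) = residue D (f x)"
proof -
  interpret C: constraint_group C by fact
  interpret D: constraint_group D by fact
  have "(\<Union>u\<in>residue C x. residue D (f u)) = residue D (f x)"
    using x by (intro C.UN_residue) (simp_all add: add zero closed D.residue_absorb)
  then show ?thesis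
    using x by (simp add: red_map_def residue_def[of D])
qed

lemma constraint_groupI:
  assumes "abelian_group (comp_T C)"
    and "subgroup (comp_N C) (add_monoid (comp_T C))" "subgroup (comp_0 C) (add_monoid (comp_T C))"
    and "comp_0 C \<subseteq> comp_N C"
  shows "constraint_group C"
  using assms
  by (simp add: constraint_group_def constraint_group_axioms_def additive_subgroup_def)

section \<open>Reduction of constraint algebras and modules\<close>

context comm_constraint_algebra
begin

sublocale T: algebra K "comp_T A"
  by (rule T_algebra)

sublocale N: subring "comp_N A" "comp_T A"
  by (rule N_subring)

sublocale I: ideal "comp_0 A" "(comp_T A)\<lparr>carrier := comp_N A\<rparr>"
  by (rule zero_ideal)

sublocale constraint_group A
proof (rule constraint_groupI)
  interpret S: subgroup "comp_0 A" "add_monoid ((comp_T A)\<lparr>carrier := comp_N A\<rparr>)"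
    by (rule I.a_subgroup)
  show sub: "comp_0 A \<subseteq> comp_N A"
    using S.subset by simp
  show N: "subgroup (comp_N A) (add_monoid (comp_T A))"
    by (rule subring.axioms(1)[OF N_subring])
  \<comment> \<open>The ideal is one of the restricted ring, so its additive subgroup property is
    first known inside \<open>comp_N A\<close> and is carried up to \<open>comp_T A\<close> by
    transitivity.\<close>
  show "subgroup (comp_0 A) (add_monoid (comp_T A))"
    using T.add.incl_subgroup[OF N] I.a_subgroup by simp
qed (rule T.M.abelian_group_axioms)

lemma N_smult [simp]: "\<lbrakk>c \<in> carrier K; x \<in> comp_N A\<rbrakk> \<Longrightarrow> c \<odot>\<^bsub>comp_T A\<^esub> x \<in> comp_N A"
  by (rule submodule.smult_closed[OF N_submodule])

lemma zero_mult_N: "\<lbrakk>x \<in> comp_0 A; y \<in> comp_N A\<rbrakk> \<Longrightarrow> x \<otimes>\<^bsub>comp_T A\<^esub> y \<in> comp_0 A"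
  using I.I_r_closed by simp

lemma N_mult_zero: "\<lbrakk>x \<in> comp_N A; y \<in> comp_0 A\<rbrakk> \<Longrightarrow> x \<otimes>\<^bsub>comp_T A\<^esub> y \<in> comp_0 A"
  using I.I_l_closed by simp

text \<open>Since c x = (c 1) x and c 1 lies in the unital subalgebra \<open>comp_N A\<close>,
  closure under scalars follows from the ideal property.\<close>

lemma zero_smult: "\<lbrakk>c \<in> carrier K; x \<in> comp_0 A\<rbrakk> \<Longrightarrow> c \<odot>\<^bsub>comp_T A\<^esub> x \<in> comp_0 A"
  using zero_mult_N[of x "c \<odot>\<^bsub>comp_T A\<^esub> \<one>\<^bsub>comp_T A\<^esub>"]
  by (metis N_carrier N_mult_zero N.one_closed N_smult T.smult_assoc2 T.l_one zero_N)

lemma carrier_red_algebra [simp]: "carrier (red_algebra A) = red_carrier A"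
  by (simp add: red_algebra_def FactRing_def red_carrier_def Let_def)

lemma zero_red_algebra: "\<zero>\<^bsub>red_algebra A\<^esub> = comp_0 A"
  by (simp add: red_algebra_def FactRing_def Let_def)

lemma one_red_algebra [simp]: "\<one>\<^bsub>red_algebra A\<^esub> = residue A \<one>\<^bsub>comp_T A\<^esub>"
  by (simp add: red_algebra_def FactRing_def Let_def residue_def a_r_coset_def')

lemma add_red_algebra: "add (red_algebra A) = set_add (comp_T A)"
  by (simp add: red_algebra_def FactRing_def Let_def set_add_def' fun_eq_iff)

lemma add_residue [simp]:
  "\<lbrakk>x \<in> comp_N A; y \<in> comp_N A\<rbrakk> \<Longrightarrow>
    residue A x \<oplus>\<^bsub>red_algebra A\<^esub> residue A y = residue A (x \<oplus>\<^bsub>comp_T A\<^esub> y)"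
  by (simp add: add_red_algebra)

text \<open>Multiplication in \<open>Quot\<close> is by definition a union of cosets over both
  representatives. The two absorption conditions are the two sides of the ideal property.\<close>

lemma mult_residue [simp]:
  assumes "x \<in> comp_N A" "y \<in> comp_N A"
  shows "residue A x \<otimes>\<^bsub>red_algebra A\<^esub> residue A y = residue A (x \<otimes>\<^bsub>comp_T A\<^esub> y)"
proof -
  have "residue A x \<otimes>\<^bsub>red_algebra A\<^esub> residue A y
      = (\<Union>u\<in>residue A x. \<Union>v\<in>residue A y. residue A (u \<otimes>\<^bsub>comp_T A\<^esub> v))"
    by (simp add: red_algebra_def FactRing_def Let_def rcoset_mult_def residue_def a_r_coset_def')
  also have "\<dots> = residue A (x \<otimes>\<^bsub>comp_T A\<^esub> y)"
    using assms
    by (intro UN_residue_biadditive constraint_group_axioms)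
      (simp_all add: T.l_distr T.r_distr zero_mult_N N_mult_zero)
  finally show ?thesis .
qed

lemma smult_residue [simp]:
  assumes "c \<in> carrier K" "x \<in> comp_N A"
  shows "c \<odot>\<^bsub>red_algebra A\<^esub> residue A x = residue A (c \<odot>\<^bsub>comp_T A\<^esub> x)"
proof -
  have "c \<odot>\<^bsub>red_algebra A\<^esub> residue A x = (\<Union>u\<in>residue A x. residue A (c \<odot>\<^bsub>comp_T A\<^esub> u))"
    by (simp add: red_algebra_def Let_def residue_def)
  also have "\<dots> = residue A (c \<odot>\<^bsub>comp_T A\<^esub> x)"
    using assms by (intro UN_residue) (simp_all add: T.smult_r_distr zero_smult residue_absorb)
  finally show ?thesis .
qed

lemma algebra_red: "algebra K (red_algebra A)"
proof (rule algebraI)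
  show "cring (red_algebra A)"
  proof (rule cringI)
    show "abelian_group (red_algebra A)"
      by (rule abelian_group_red) (simp_all add: zero_red_algebra add_red_algebra)
    show "comm_monoid (red_algebra A)"
      by (rule comm_monoidI) (auto simp: red_carrier_eq T.m_ac)
  qed (auto simp: red_carrier_eq T.l_distr)
qed (auto simp: red_carrier_eq T.smult_l_distr T.smult_r_distr T.smult_assoc1 T.smult_assoc2
  intro: T.R_cring)

text \<open>The bracket of \<open>Der\<close> is a commutator written with subtraction, so
  subtraction in the quotient must also be computed on representatives. The negative is identified
  by uniqueness of additive inverses.\<close>

lemma residue_minus:
  assumes "a \<in> comp_N A" "b \<in> comp_N A"
  shows "residue A a \<ominus>\<^bsub>red_algebra A\<^esub> residue A b = residue A (a \<ominus>\<^bsub>comp_T A\<^esub> b)"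
proof -
  interpret R: algebra K "red_algebra A"
    by (rule algebra_red)
  have "residue A (\<ominus>\<^bsub>comp_T A\<^esub> b) \<oplus>\<^bsub>red_algebra A\<^esub> residue A b = \<zero>\<^bsub>red_algebra A\<^esub>"
    using assms by (simp add: T.M.l_neg zero_red_algebra residue_zero)
  then have "\<ominus>\<^bsub>red_algebra A\<^esub> residue A b = residue A (\<ominus>\<^bsub>comp_T A\<^esub> b)"
    using assms by (intro R.M.minus_equality) simp_all
  then show ?thesis
    using assms by (simp add: a_minus_def)
qed

end

locale red_constraint_module =
  A: comm_constraint_algebra K A + constraint_module A E
  for K :: "('k, 'm) ring_scheme" and A :: "(('k, 'a) module, 'a) constraint"
    and E :: "(('a, 'e) lie_module, 'e) constraint"
begin

sublocale T: module "comp_T A" "comp_T E"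
  by (rule T_module)

sublocale constraint_group E
  by (rule constraint_groupI)
    (simp_all add: T.abelian_group_axioms zero_subset
      submodule.axioms(1)[OF N_submodule] submodule.axioms(1)[OF zero_submodule])

lemma N_smult [simp]:
  "\<lbrakk>a \<in> comp_N A; x \<in> comp_N E\<rbrakk> \<Longrightarrow> a \<odot>\<^bsub>comp_T E\<^esub> x \<in> comp_N E"
  using submodule.smult_closed[OF N_submodule] by simp

lemma N_smult_zero:
  "\<lbrakk>a \<in> comp_N A; x \<in> comp_0 E\<rbrakk> \<Longrightarrow> a \<odot>\<^bsub>comp_T E\<^esub> x \<in> comp_0 E"
  using submodule.smult_closed[OF zero_submodule] by simp

lemma carrier_red_lie_module [simp]: "carrier (red_lie_module E) = red_carrier E"
  by (simp add: red_lie_module_def)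

lemma zero_red_lie_module: "\<zero>\<^bsub>red_lie_module E\<^esub> = residue E \<zero>\<^bsub>comp_T E\<^esub>"
  by (simp add: red_lie_module_def residue_zero)

lemma add_residue [simp]:
  "\<lbrakk>x \<in> comp_N E; y \<in> comp_N E\<rbrakk> \<Longrightarrow>
    residue E x \<oplus>\<^bsub>red_lie_module E\<^esub> residue E y = residue E (x \<oplus>\<^bsub>comp_T E\<^esub> y)"
  by (simp add: red_lie_module_def)

text \<open>Independence of the representative of the scalar is the condition that
  \<open>comp_0 A\<close> maps \<open>comp_N E\<close> into \<open>comp_0 E\<close>; independence of
  the vector is the submodule property of \<open>comp_0 E\<close>.\<close>

lemma smult_residue [simp]:
  assumes "a \<in> comp_N A" "x \<in> comp_N E"
  shows "residue A a \<odot>\<^bsub>red_lie_module E\<^esub> residue E x = residue E (a \<odot>\<^bsub>comp_T E\<^esub> x)"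
proof -
  have "residue A a \<odot>\<^bsub>red_lie_module E\<^esub> residue E x
      = (\<Union>b\<in>residue A a. \<Union>y\<in>residue E x. residue E (b \<odot>\<^bsub>comp_T E\<^esub> y))"
    by (simp add: red_lie_module_def residue_def[of E])
  also have "\<dots> = residue E (a \<odot>\<^bsub>comp_T E\<^esub> x)"
    using assms
    by (intro UN_residue_biadditive constraint_group_axioms A.constraint_group_axioms)
      (simp_all add: T.smult_l_distr T.smult_r_distr N_smult_zero zero_smult)
  finally show ?thesis .
qed

lemma module_red: "module (red_algebra A) (red_lie_module E)"
proof (rule moduleI)
  show "cring (red_algebra A)"
    by (rule algebra.M_cring[OF A.algebra_red])
  show "abelian_group (red_lie_module E)"
    by (rule abelian_group_red) (simp_all add: red_lie_module_def)
qed (auto simp: red_carrier_eq A.red_carrier_eq T.smult_l_distr T.smult_r_distr T.smult_assoc1)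

end

section \<open>Derivations\<close>

lemma Der_simps [simp]:
  "zero (Der K A) = (\<lambda>a\<in>carrier A. \<zero>\<^bsub>A\<^esub>)"
  "\<delta> \<oplus>\<^bsub>Der K A\<^esub> \<epsilon> = (\<lambda>a\<in>carrier A. \<delta> a \<oplus>\<^bsub>A\<^esub> \<epsilon> a)"
  "b \<odot>\<^bsub>Der K A\<^esub> \<delta> = (\<lambda>a\<in>carrier A. b \<otimes>\<^bsub>A\<^esub> \<delta> a)"
  "lie_bracket (Der K A) \<delta> \<epsilon> = (\<lambda>a\<in>carrier A. \<delta> (\<epsilon> a) \<ominus>\<^bsub>A\<^esub> \<epsilon> (\<delta> a))"
  by (simp_all add: Der_def)

lemma DerI:
  assumes "\<delta> \<in> extensional (carrier A)"
    and "\<And>a. a \<in> carrier A \<Longrightarrow> \<delta> a \<in> carrier A"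
    and "\<And>a b. \<lbrakk>a \<in> carrier A; b \<in> carrier A\<rbrakk> \<Longrightarrow> \<delta> (a \<oplus>\<^bsub>A\<^esub> b) = \<delta> a \<oplus>\<^bsub>A\<^esub> \<delta> b"
    and "\<And>c a. \<lbrakk>c \<in> carrier K; a \<in> carrier A\<rbrakk> \<Longrightarrow> \<delta> (c \<odot>\<^bsub>A\<^esub> a) = c \<odot>\<^bsub>A\<^esub> \<delta> a"
    and "\<And>a b. \<lbrakk>a \<in> carrier A; b \<in> carrier A\<rbrakk> \<Longrightarrow>
      \<delta> (a \<otimes>\<^bsub>A\<^esub> b) = \<delta> a \<otimes>\<^bsub>A\<^esub> b \<oplus>\<^bsub>A\<^esub> a \<otimes>\<^bsub>A\<^esub> \<delta> b"
  shows "\<delta> \<in> carrier (Der K A)"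
  using assms by (simp add: Der_def module_hom_def)

lemma DerE:
  assumes "\<delta> \<in> carrier (Der K A)"
  shows "\<delta> \<in> extensional (carrier A)"
    and "\<And>a. a \<in> carrier A \<Longrightarrow> \<delta> a \<in> carrier A"
    and "\<And>a b. \<lbrakk>a \<in> carrier A; b \<in> carrier A\<rbrakk> \<Longrightarrow> \<delta> (a \<oplus>\<^bsub>A\<^esub> b) = \<delta> a \<oplus>\<^bsub>A\<^esub> \<delta> b"
    and "\<And>c a. \<lbrakk>c \<in> carrier K; a \<in> carrier A\<rbrakk> \<Longrightarrow> \<delta> (c \<odot>\<^bsub>A\<^esub> a) = c \<odot>\<^bsub>A\<^esub> \<delta> a"
    and "\<And>a b. \<lbrakk>a \<in> carrier A; b \<in> carrier A\<rbrakk> \<Longrightarrow>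
      \<delta> (a \<otimes>\<^bsub>A\<^esub> b) = \<delta> a \<otimes>\<^bsub>A\<^esub> b \<oplus>\<^bsub>A\<^esub> a \<otimes>\<^bsub>A\<^esub> \<delta> b"
  using assms by (auto simp: Der_def module_hom_def)

context algebra
begin

lemma Der_zero: "(\<lambda>a\<in>carrier M. \<zero>\<^bsub>M\<^esub>) \<in> carrier (Der R M)"
  by (rule DerI) simp_all

lemma Der_add:
  assumes "\<delta> \<in> carrier (Der R M)" "\<epsilon> \<in> carrier (Der R M)"
  shows "(\<lambda>a\<in>carrier M. \<delta> a \<oplus>\<^bsub>M\<^esub> \<epsilon> a) \<in> carrier (Der R M)"
  using DerE[OF assms(1)] DerE[OF assms(2)]
  by (intro DerI) (simp_all add: smult_r_distr l_distr r_distr a_ac)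

lemma Der_uminus:
  assumes "\<delta> \<in> carrier (Der R M)"
  shows "(\<lambda>a\<in>carrier M. \<ominus>\<^bsub>M\<^esub> \<delta> a) \<in> carrier (Der R M)"
  using DerE[OF assms]
  by (intro DerI) (simp_all add: smult_r_minus minus_add l_minus r_minus)

lemma Der_left_inverse:
  "\<delta> \<in> carrier (Der R M) \<Longrightarrow>
    (\<lambda>a\<in>carrier M. \<ominus>\<^bsub>M\<^esub> \<delta> a) \<oplus>\<^bsub>Der R M\<^esub> \<delta> = \<zero>\<^bsub>Der R M\<^esub>"
  by (auto simp: fun_eq_iff restrict_def DerE l_neg)

lemma abelian_group_Der: "abelian_group (Der R M)"
proof (rule abelian_groupI)
  show "\<exists>\<epsilon>\<in>carrier (Der R M). \<epsilon> \<oplus>\<^bsub>Der R M\<^esub> \<delta> = \<zero>\<^bsub>Der R M\<^esub>"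
    if "\<delta> \<in> carrier (Der R M)" for \<delta>
    using that Der_uminus Der_left_inverse by blast
\<comment> \<open>The neutral law is an equality of functions: off the carrier it holds because a
  derivation is \<open>undefined\<close> there.\<close>
qed (auto simp: Der_zero Der_add DerE a_ac fun_eq_iff extensional_arb[OF DerE(1)])

text \<open>Makes the abstract inverse pointwise, so that closure of the components of
  \<open>CDer\<close> under negation can be checked on values.\<close>

lemma Der_a_inv:
  assumes "\<delta> \<in> carrier (Der R M)"
  shows "\<ominus>\<^bsub>Der R M\<^esub> \<delta> = (\<lambda>a\<in>carrier M. \<ominus>\<^bsub>M\<^esub> \<delta> a)"
  using abelian_group.minus_equality[OF abelian_group_Der Der_left_inverse[OF assms]]
    Der_uminus assms by blast

end

lemma CDer_simps [simp]:
  "comp_T (CDer K A) = Der K (comp_T A)"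
  by (simp add: CDer_def)

lemma CDer_N_iff:
  "\<delta> \<in> comp_N (CDer K A) \<longleftrightarrow> \<delta> \<in> carrier (Der K (comp_T A)) \<and>
    (\<forall>a\<in>comp_N A. \<delta> a \<in> comp_N A) \<and> (\<forall>a\<in>comp_0 A. \<delta> a \<in> comp_0 A)"
  by (auto simp: CDer_def)

lemma CDer_0_iff:
  "\<delta> \<in> comp_0 (CDer K A) \<longleftrightarrow> \<delta> \<in> carrier (Der K (comp_T A)) \<and> (\<forall>a\<in>comp_N A. \<delta> a \<in> comp_0 A)"
  by (auto simp: CDer_def)

context comm_constraint_algebra
begin

lemma constraint_group_CDer: "constraint_group (CDer K A)"
proof (rule constraint_groupI)
  interpret D: abelian_group "Der K (comp_T A)"
    by (rule T.abelian_group_Der)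
  show "abelian_group (comp_T (CDer K A))"
    by (simp add: T.abelian_group_Der)
  have "(\<lambda>a\<in>carrier (comp_T A). \<zero>\<^bsub>comp_T A\<^esub>) \<in> comp_N (CDer K A)"
    "(\<lambda>a\<in>carrier (comp_T A). \<zero>\<^bsub>comp_T A\<^esub>) \<in> comp_0 (CDer K A)"
    by (simp_all add: CDer_N_iff CDer_0_iff T.Der_zero)
  then have nonempty: "comp_N (CDer K A) \<noteq> {}" "comp_0 (CDer K A) \<noteq> {}"
    by blast+
  show "subgroup (comp_N (CDer K A)) (add_monoid (comp_T (CDer K A)))"
    unfolding CDer_simps
    by (intro D.add.subgroupI nonempty) (auto simp: CDer_N_iff T.Der_a_inv T.Der_uminus T.Der_add)
  show "subgroup (comp_0 (CDer K A)) (add_monoid (comp_T (CDer K A)))"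
    unfolding CDer_simps
    by (intro D.add.subgroupI nonempty) (auto simp: CDer_0_iff T.Der_a_inv T.Der_uminus T.Der_add)
  \<comment> \<open>A derivation sending \<open>comp_N A\<close> into \<open>comp_0 A\<close>
    preserves both components because \<open>comp_0 A\<close> is contained in
    \<open>comp_N A\<close>.\<close>
  show "comp_0 (CDer K A) \<subseteq> comp_N (CDer K A)"
    by (auto simp: CDer_0_iff CDer_N_iff)
qed

text \<open>Evaluation of a derivation at an element is biadditive. Its absorption conditions are
  what the components of \<open>CDer\<close> demand: 0-derivations send \<open>comp_N A\<close> into
  \<open>comp_0 A\<close>, and N-derivations preserve \<open>comp_0 A\<close>.\<close>

lemma red_der_embed_residue:
  assumes \<delta>: "\<delta> \<in> comp_N (CDer K A)" and a: "a \<in> comp_N A"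
  shows "red_der_embed A (residue (CDer K A) \<delta>) (residue A a) = residue A (\<delta> a)"
proof -
  have "red_der_embed A (residue (CDer K A) \<delta>) (residue A a)
      = (\<Union>\<epsilon>\<in>residue (CDer K A) \<delta>. \<Union>b\<in>residue A a. residue A (\<epsilon> b))"
    using residue_in_red_carrier[OF a] by (simp add: red_der_embed_def residue_def)
  also have "\<dots> = residue A (\<delta> a)"
    using assms
    by (intro UN_residue_biadditive constraint_group_axioms constraint_group_CDer)
      (auto simp: CDer_N_iff CDer_0_iff DerE)
  finally show ?thesis .
qed

end

section \<open>Reduction of constraint Lie-Rinehart algebras\<close>

lemma restrict_scalars_simps [simp]:
  "carrier (restrict_scalars A L) = carrier L"
  "zero (restrict_scalars A L) = zero L"
  "add (restrict_scalars A L) = add L"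
  "smult (restrict_scalars A L) = (\<lambda>c x. (c \<odot>\<^bsub>A\<^esub> \<one>\<^bsub>A\<^esub>) \<odot>\<^bsub>L\<^esub> x)"
  "lie_bracket (restrict_scalars A L) = lie_bracket L"
  by (simp_all add: restrict_scalars_def)

lemma (in algebra) smult_one_mult:
  assumes "a \<in> carrier R" "x \<in> carrier M"
  shows "(a \<odot>\<^bsub>M\<^esub> \<one>\<^bsub>M\<^esub>) \<otimes>\<^bsub>M\<^esub> x = a \<odot>\<^bsub>M\<^esub> x"
  using assms by (simp add: smult_assoc2)

lemma module_restrict_scalars:
  assumes "algebra K A" "module A L"
  shows "module K (restrict_scalars A L)"
proof -
  interpret A: algebra K A by fact
  interpret L: module A L by fact
  show ?thesis
  proof (rule moduleI)
    show "abelian_group (restrict_scalars A L)"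
      using abelian_groupE[OF L.abelian_group_axioms] by (intro abelian_groupI) simp_all
  next
    fix a b x
    assume *: "a \<in> carrier K" "b \<in> carrier K" "x \<in> carrier (restrict_scalars A L)"
    \<comment> \<open>The unit map c -> c 1 is multiplicative; this is what associativity of the
      restricted action requires.\<close>
    then have "(a \<otimes>\<^bsub>K\<^esub> b) \<odot>\<^bsub>A\<^esub> \<one>\<^bsub>A\<^esub> = (a \<odot>\<^bsub>A\<^esub> \<one>\<^bsub>A\<^esub>) \<otimes>\<^bsub>A\<^esub> (b \<odot>\<^bsub>A\<^esub> \<one>\<^bsub>A\<^esub>)"
      by (simp add: A.smult_one_mult A.smult_assoc1)
    then show "(a \<otimes>\<^bsub>K\<^esub> b) \<odot>\<^bsub>restrict_scalars A L\<^esub> x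
        = a \<odot>\<^bsub>restrict_scalars A L\<^esub> (b \<odot>\<^bsub>restrict_scalars A L\<^esub> x)"
      using * by (simp add: L.smult_assoc1)
  qed (simp_all add: A.R_cring A.smult_l_distr L.smult_l_distr L.smult_r_distr)
qed

lemma constraint_restrict_scalars_simps [simp]:
  "comp_T (constraint_restrict_scalars A L) = restrict_scalars (comp_T A) (comp_T L)"
  "comp_N (constraint_restrict_scalars A L) = comp_N L"
  "comp_0 (constraint_restrict_scalars A L) = comp_0 L"
  by (simp_all add: constraint_restrict_scalars_def)

lemma red_lie_rinehart_simps [simp]:
  "lr_alg (red_lie_rinehart K X) = red_algebra (clr_alg X)"
  "lr_lie (red_lie_rinehart K X) = red_lie_module (clr_lie X)"
  by (simp_all add: red_lie_rinehart_def)

context constraint_lie_rinehart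
begin

abbreviation A where "A \<equiv> clr_alg X"
abbreviation G where "G \<equiv> clr_lie X"
abbreviation \<rho> where "\<rho> \<equiv> clr_anchor X"
abbreviation bracket where "bracket \<equiv> lie_bracket (comp_T G)"

sublocale red_constraint_module K A G
  using alg mod by (rule red_constraint_module.intro)

sublocale L: constraint_lie_algebra K "constraint_restrict_scalars A G"
  by (rule lie)

lemma lie_algebra_T: "lie_algebra K (restrict_scalars (comp_T A) (comp_T G))"
  using L.T_lie_algebra by simp

text \<open>The Lie axioms with \<open>restrict_scalars\<close> unfolded, so that they speak of
  \<open>comp_T G\<close> itself and a scalar c acts as c 1.\<close>

lemmas bracket_closed [simp] = lie_algebra.bracket_closed[OF lie_algebra_T, simplified]
lemmas bracket_add_left = lie_algebra.bracket_add_left[OF lie_algebra_T, simplified]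
lemmas bracket_add_right = lie_algebra.bracket_add_right[OF lie_algebra_T, simplified]
lemmas bracket_smult_left = lie_algebra.bracket_smult_left[OF lie_algebra_T, simplified]
lemmas bracket_smult_right = lie_algebra.bracket_smult_right[OF lie_algebra_T, simplified]
lemmas bracket_alternating = lie_algebra.bracket_alternating[OF lie_algebra_T, simplified]
lemmas jacobi = lie_algebra.jacobi[OF lie_algebra_T, simplified]
lemmas bracket_N_N [simp] = L.bracket_N_N[simplified]
lemmas bracket_N_zero = L.bracket_N_zero[simplified]

text \<open>The axiom gives absorption in the second argument only; antisymmetry carries it to the
  first, since \<open>comp_0 G\<close> is closed under negation.\<close>

lemma bracket_zero_N:
  assumes x: "x \<in> comp_0 G" and y: "y \<in> comp_N G"
  shows "bracket x y \<in> comp_0 G"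
proof -
  have xy: "x \<in> carrier (comp_T G)" "y \<in> carrier (comp_T G)"
    using assms by simp_all
  \<comment> \<open>Antisymmetry is obtained by polarizing the alternating law, which is valid in
    every characteristic.\<close>
  have "bracket (x \<oplus>\<^bsub>comp_T G\<^esub> y) (x \<oplus>\<^bsub>comp_T G\<^esub> y) = bracket x y \<oplus>\<^bsub>comp_T G\<^esub> bracket y x"
    using xy bracket_alternating[of x] bracket_alternating[of y]
    by (simp add: bracket_add_left bracket_add_right T.M.a_comm)
  then have "bracket x y \<oplus>\<^bsub>comp_T G\<^esub> bracket y x = \<zero>\<^bsub>comp_T G\<^esub>"
    using xy by (simp add: bracket_alternating)
  then have "bracket x y = \<ominus>\<^bsub>comp_T G\<^esub> bracket y x"
    using xy by (metis T.M.minus_equality bracket_closed)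
  then show ?thesis
    using bracket_N_zero[OF y x] by simp
qed

lemma bracket_residue [simp]:
  assumes "x \<in> comp_N G" "y \<in> comp_N G"
  shows "lie_bracket (red_lie_module G) (residue G x) (residue G y) = residue G (bracket x y)"
proof -
  have "lie_bracket (red_lie_module G) (residue G x) (residue G y)
      = (\<Union>u\<in>residue G x. \<Union>v\<in>residue G y. residue G (bracket u v))"
    by (simp add: red_lie_module_def residue_def)
  also have "\<dots> = residue G (bracket x y)"
    using assms
    by (intro UN_residue_biadditive constraint_group_axioms)
      (simp_all add: bracket_add_left bracket_add_right bracket_zero_N bracket_N_zero)
  finally show ?thesis .
qed

lemma lie_algebra_red: "lie_algebra K (restrict_scalars (red_algebra A) (red_lie_module G))"
proof (rule lie_algebra.intro)
  show "module K (restrict_scalars (red_algebra A) (red_lie_module G))"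
    by (rule module_restrict_scalars[OF A.algebra_red module_red])
  show "lie_algebra_axioms K (restrict_scalars (red_algebra A) (red_lie_module G))"
    by unfold_locales
      (auto simp: red_carrier_eq bracket_add_left bracket_add_right bracket_smult_left
        bracket_smult_right bracket_alternating jacobi zero_red_lie_module)
qed

lemma anchor_Der: "\<xi> \<in> carrier (comp_T G) \<Longrightarrow> \<rho> \<xi> \<in> carrier (Der K (comp_T A))"
  using anchor_module_hom by (auto simp: constraint_module_hom_def module_hom_def)

lemma anchor_closed [simp]:
  "\<lbrakk>\<xi> \<in> carrier (comp_T G); a \<in> carrier (comp_T A)\<rbrakk> \<Longrightarrow> \<rho> \<xi> a \<in> carrier (comp_T A)"
  using DerE(2)[OF anchor_Der] .

lemma anchor_CDer_N: "\<xi> \<in> comp_N G \<Longrightarrow> \<rho> \<xi> \<in> comp_N (CDer K A)"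
  using anchor_module_hom by (auto simp: constraint_module_hom_def constraint_maps_def)

lemma anchor_CDer_0: "\<xi> \<in> comp_0 G \<Longrightarrow> \<rho> \<xi> \<in> comp_0 (CDer K A)"
  using anchor_module_hom by (auto simp: constraint_module_hom_def constraint_maps_def)

lemma anchor_N [simp]: "\<lbrakk>\<xi> \<in> comp_N G; a \<in> comp_N A\<rbrakk> \<Longrightarrow> \<rho> \<xi> a \<in> comp_N A"
  using anchor_CDer_N by (simp add: CDer_N_iff)

lemma anchor_add:
  "\<lbrakk>\<xi> \<in> carrier (comp_T G); \<eta> \<in> carrier (comp_T G)\<rbrakk> \<Longrightarrow>
    \<rho> (\<xi> \<oplus>\<^bsub>comp_T G\<^esub> \<eta>) = \<rho> \<xi> \<oplus>\<^bsub>Der K (comp_T A)\<^esub> \<rho> \<eta>"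
  using anchor_module_hom by (simp add: constraint_module_hom_def module_hom_def)

lemma anchor_smult:
  "\<lbrakk>a \<in> carrier (comp_T A); \<xi> \<in> carrier (comp_T G)\<rbrakk> \<Longrightarrow>
    \<rho> (a \<odot>\<^bsub>comp_T G\<^esub> \<xi>) = a \<odot>\<^bsub>Der K (comp_T A)\<^esub> \<rho> \<xi>"
  using anchor_module_hom by (simp add: constraint_module_hom_def module_hom_def)

lemma anchor_bracket:
  "\<lbrakk>\<xi> \<in> carrier (comp_T G); \<eta> \<in> carrier (comp_T G)\<rbrakk> \<Longrightarrow>
    \<rho> (bracket \<xi> \<eta>) = lie_bracket (Der K (comp_T A)) (\<rho> \<xi>) (\<rho> \<eta>)"
  using anchor_lie_hom by (simp add: constraint_lie_hom_def lie_hom_def)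

abbreviation \<rho>_red where "\<rho>_red \<equiv> lr_anchor (red_lie_rinehart K X)"

text \<open>The reduced anchor works in two stages: the class of \<xi> goes to the class of the
  derivation \<open>\<rho> \<xi>\<close> modulo \<open>comp_0 (CDer K A)\<close>, and this class is
  then evaluated at the class of a.\<close>

lemma anchor_residue [simp]:
  assumes "\<xi> \<in> comp_N G" "a \<in> comp_N A"
  shows "\<rho>_red (residue G \<xi>) (residue A a) = residue A (\<rho> \<xi> a)"
proof -
  have "red_map G (CDer K A) \<rho> (residue G \<xi>) = residue (CDer K A) (\<rho> \<xi>)"
    using assms(1)
    by (intro red_map_residue constraint_group_axioms A.constraint_group_CDer)
      (simp_all add: anchor_CDer_N anchor_CDer_0 anchor_add)
  then show ?thesis
    using assms by (simp add: red_lie_rinehart_def A.red_der_embed_residue anchor_CDer_N)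
qed

lemma anchor_red_extensional: "\<rho>_red P \<in> extensional (red_carrier A)"
  by (simp add: red_lie_rinehart_def red_der_embed_def)

text \<open>Identities in \<open>Der\<close> are equalities of functions. Both sides are
  extensional, so it suffices to compare them on classes.\<close>

lemma anchor_red_eqI:
  assumes "\<delta> \<in> extensional (red_carrier A)"
    and "\<And>a. a \<in> comp_N A \<Longrightarrow> \<rho>_red P (residue A a) = \<delta> (residue A a)"
  shows "\<rho>_red P = \<delta>"
  by (rule extensionalityI[OF anchor_red_extensional assms(1)])
    (auto simp: A.red_carrier_eq assms(2))

lemma anchor_red_Der:
  assumes "P \<in> red_carrier G"
  shows "\<rho>_red P \<in> carrier (Der K (red_algebra A))"
proof -
  obtain \<xi> where \<xi>: "\<xi> \<in> comp_N G" "P = residue G \<xi>"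
    using assms by (auto simp: red_carrier_eq)
  note der = DerE[OF anchor_Der[OF N_carrier[OF \<xi>(1)]]]
  show ?thesis
    by (rule DerI) (auto simp: anchor_red_extensional[unfolded A.red_carrier_eq] A.red_carrier_eq \<xi> der)
qed

lemma anchor_red_module_hom:
  "\<rho>_red \<in> module_hom (red_algebra A) (red_lie_module G) (Der K (red_algebra A))"
  unfolding module_hom_def
  by (auto simp: anchor_red_Der red_carrier_eq A.red_carrier_eq anchor_add anchor_smult
    intro!: anchor_red_eqI)

lemma anchor_red_lie_hom:
  "\<rho>_red \<in> lie_hom K (restrict_scalars (red_algebra A) (red_lie_module G))
    (restrict_scalars (red_algebra A) (Der K (red_algebra A)))"
proof -
  \<comment> \<open>Linearity over \<open>K\<close> is linearity over the reduced algebra at the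
    scalar c 1. The operations of \<open>Der\<close> stay folded so that the two statements
    match.\<close>
  have "\<rho>_red \<in> module_hom K (restrict_scalars (red_algebra A) (red_lie_module G))
      (restrict_scalars (red_algebra A) (Der K (red_algebra A)))"
    using anchor_red_module_hom unfolding module_hom_def by (simp del: Der_simps)
  then show ?thesis
    unfolding lie_hom_def
    by (auto simp: red_carrier_eq anchor_bracket A.residue_minus intro!: anchor_red_eqI)
qed

theorem lie_rinehart_red: "lie_rinehart K (red_lie_rinehart K X)"
  by (rule lie_rinehart.intro)
    (auto simp: A.algebra_red module_red lie_algebra_red anchor_red_lie_hom anchor_red_module_hom
      red_carrier_eq A.red_carrier_eq leibniz)

end

section \<open>Reduction of morphisms\<close>

lemma module_hom_add:
  "\<lbrakk>f \<in> module_hom R M N; x \<in> carrier M; y \<in> carrier M\<rbrakk> \<Longrightarrow> f (x \<oplus>\<^bsub>M\<^esub> y) = f x \<oplus>\<^bsub>N\<^esub> f y"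
  by (simp add: module_hom_def)

lemma constraint_lie_rinehart_homD:
  assumes "(\<phi>, \<Phi>) \<in> constraint_lie_rinehart_hom K X Y"
  shows "\<phi> \<in> ring_hom (comp_T (clr_alg X)) (comp_T (clr_alg Y))"
    and "\<phi> \<in> module_hom K (comp_T (clr_alg X)) (comp_T (clr_alg Y))"
    and "\<And>a. a \<in> comp_N (clr_alg X) \<Longrightarrow> \<phi> a \<in> comp_N (clr_alg Y)"
    and "\<And>a. a \<in> comp_0 (clr_alg X) \<Longrightarrow> \<phi> a \<in> comp_0 (clr_alg Y)"
    and "\<Phi> \<in> lie_hom K (restrict_scalars (comp_T (clr_alg X)) (comp_T (clr_lie X)))
      (restrict_scalars (comp_T (clr_alg Y)) (comp_T (clr_lie Y)))"
    and "\<And>\<xi>. \<xi> \<in> comp_N (clr_lie X) \<Longrightarrow> \<Phi> \<xi> \<in> comp_N (clr_lie Y)"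
    and "\<And>\<xi>. \<xi> \<in> comp_0 (clr_lie X) \<Longrightarrow> \<Phi> \<xi> \<in> comp_0 (clr_lie Y)"
    and "\<And>a \<xi>. \<lbrakk>a \<in> carrier (comp_T (clr_alg X)); \<xi> \<in> carrier (comp_T (clr_lie X))\<rbrakk> \<Longrightarrow>
      \<Phi> (a \<odot>\<^bsub>comp_T (clr_lie X)\<^esub> \<xi>) = \<phi> a \<odot>\<^bsub>comp_T (clr_lie Y)\<^esub> \<Phi> \<xi>"
    and "\<And>a \<xi>. \<lbrakk>a \<in> carrier (comp_T (clr_alg X)); \<xi> \<in> carrier (comp_T (clr_lie X))\<rbrakk> \<Longrightarrow>
      clr_anchor Y (\<Phi> \<xi>) (\<phi> a) = \<phi> (clr_anchor X \<xi> a)"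
  using assms
  by (auto simp: constraint_lie_rinehart_hom_def constraint_algebra_hom_def algebra_hom_def
    constraint_lie_hom_def constraint_maps_def)

text \<open>Both components are additive and preserve the N- and 0-components, so they descend to
  classes. The morphism laws and functoriality all rest on these two evaluation formulas.\<close>

lemma red_map_residue_hom:
  assumes "constraint_lie_rinehart K X" "constraint_lie_rinehart K Y"
    and hom: "(\<phi>, \<Phi>) \<in> constraint_lie_rinehart_hom K X Y"
  shows "a \<in> comp_N (clr_alg X) \<Longrightarrow>
      red_map (clr_alg X) (clr_alg Y) \<phi> (residue (clr_alg X) a) = residue (clr_alg Y) (\<phi> a)"
    and "\<xi> \<in> comp_N (clr_lie X) \<Longrightarrow>
      red_map (clr_lie X) (clr_lie Y) \<Phi> (residue (clr_lie X) \<xi>) = residue (clr_lie Y) (\<Phi> \<xi>)"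
proof -
  interpret X: constraint_lie_rinehart K X by fact
  interpret Y: constraint_lie_rinehart K Y by fact
  note homD = constraint_lie_rinehart_homD[OF hom]
  have "\<Phi> (\<xi> \<oplus>\<^bsub>comp_T X.G\<^esub> \<eta>) = \<Phi> \<xi> \<oplus>\<^bsub>comp_T Y.G\<^esub> \<Phi> \<eta>"
    if "\<xi> \<in> comp_N X.G" "\<eta> \<in> comp_N X.G" for \<xi> \<eta>
    using homD(5) that by (auto simp: lie_hom_def module_hom_def)
  then show "\<xi> \<in> comp_N X.G \<Longrightarrow> red_map X.G Y.G \<Phi> (residue X.G \<xi>) = residue Y.G (\<Phi> \<xi>)"
    by (intro red_map_residue X.constraint_group_axioms Y.constraint_group_axioms)
      (auto simp: homD)
  show "a \<in> comp_N X.A \<Longrightarrow> red_map X.A Y.A \<phi> (residue X.A a) = residue Y.A (\<phi> a)"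
    by (intro red_map_residue X.A.constraint_group_axioms Y.A.constraint_group_axioms)
      (auto simp: homD module_hom_add[OF homD(2)])
qed

theorem red_lie_rinehart_hom_in_hom:
  assumes "constraint_lie_rinehart K X" "constraint_lie_rinehart K Y"
    and hom: "(\<phi>, \<Phi>) \<in> constraint_lie_rinehart_hom K X Y"
  shows "red_lie_rinehart_hom X Y (\<phi>, \<Phi>)
    \<in> lie_rinehart_hom K (red_lie_rinehart K X) (red_lie_rinehart K Y)"
proof -
  interpret X: constraint_lie_rinehart K X by fact
  interpret Y: constraint_lie_rinehart K Y by fact
  let ?\<phi> = "red_map X.A Y.A \<phi>" and ?\<Phi> = "red_map X.G Y.G \<Phi>"
  note homD = constraint_lie_rinehart_homD[OF hom]
  note residue = red_map_residue_hom[OF assms]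
  \<comment> \<open>These rules replace classes by representatives and reduced maps by their values,
    after which every law becomes the corresponding law for \<open>\<phi>\<close> and
    \<open>\<Phi>\<close>.\<close>
  note eqs = X.red_carrier_eq X.A.red_carrier_eq residue homD
  have \<phi>: "?\<phi> \<in> ring_hom (red_algebra X.A) (red_algebra Y.A)"
    using ring_hom_mult[OF homD(1)] ring_hom_add[OF homD(1)] ring_hom_one[OF homD(1)]
    by (intro ring_hom_memI) (auto simp: eqs)
  have \<phi>': "?\<phi> \<in> module_hom K (red_algebra X.A) (red_algebra Y.A)"
    using homD(2) unfolding module_hom_def
    by (auto simp: eqs)
  have \<Phi>: "?\<Phi> \<in> lie_hom K (restrict_scalars (red_algebra X.A) (red_lie_module X.G))
      (restrict_scalars (red_algebra Y.A) (red_lie_module Y.G))"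
    using homD(5) unfolding lie_hom_def module_hom_def
    by (auto simp: eqs)
  show ?thesis
    unfolding red_lie_rinehart_hom_def lie_rinehart_hom_def algebra_hom_def
    using \<phi> \<phi>' \<Phi> red_map_extensional[of X.A Y.A \<phi>] red_map_extensional[of X.G Y.G \<Phi>]
    by (auto simp: eqs)
qed

section \<open>The reduction functor\<close>

lemma compose_module_hom:
  assumes "f \<in> module_hom R L M" "g \<in> module_hom R M N" "module R L"
  shows "compose (carrier L) g f \<in> module_hom R L N"
proof -
  \<comment> \<open>\<open>compose\<close> is meaningful only on the carrier, so sums and scalar
    multiples must be known to stay inside it.\<close>
  interpret L: module R L by fact
  show ?thesis
    using assms(1,2) by (auto simp: module_hom_def compose_def Pi_iff)
qed

lemma id_module_hom: "module R L \<Longrightarrow> (\<lambda>x\<in>carrier L. x) \<in> module_hom R L L"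
proof -
  assume "module R L"
  then interpret L: module R L .
  show ?thesis
    by (simp add: module_hom_def)
qed

lemma compose_ring_hom:
  assumes "f \<in> ring_hom A B" "g \<in> ring_hom B C" "ring A"
  shows "compose (carrier A) g f \<in> ring_hom A C"
proof -
  interpret A: ring A by fact
  show ?thesis
    using ring_hom_trans[OF assms(1,2)]
    by (simp add: ring_hom_def compose_def Pi_iff)
qed

lemma id_ring_hom: "ring A \<Longrightarrow> (\<lambda>x\<in>carrier A. x) \<in> ring_hom A A"
proof -
  assume "ring A"
  then interpret A: ring A .
  show ?thesis
    by (simp add: ring_hom_def)
qed

lemma compose_algebra_hom:
  assumes "f \<in> algebra_hom K A B" "g \<in> algebra_hom K B C" "algebra K A"
  shows "compose (carrier A) g f \<in> algebra_hom K A C"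
proof -
  interpret A: algebra K A by fact
  show ?thesis
    using assms(1,2)
    by (auto simp: algebra_hom_def
      intro: compose_ring_hom compose_module_hom cring.axioms(1)[OF A.M_cring] A.module)
qed

lemma id_algebra_hom: "algebra K A \<Longrightarrow> (\<lambda>x\<in>carrier A. x) \<in> algebra_hom K A A"
proof -
  assume "algebra K A"
  then interpret A: algebra K A .
  show ?thesis
    using id_ring_hom[OF cring.axioms(1)[OF A.M_cring]] id_module_hom[OF A.module]
    by (simp add: algebra_hom_def)
qed

lemma compose_lie_hom:
  assumes "f \<in> lie_hom K L M" "g \<in> lie_hom K M N" "lie_algebra K L"
  shows "compose (carrier L) g f \<in> lie_hom K L N"
proof -
  interpret L: lie_algebra K L by fact
  have "compose (carrier L) g f \<in> module_hom K L N"
    using assms(1,2) by (auto simp: lie_hom_def intro: compose_module_hom L.module_axioms)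
  then show ?thesis
    using assms(1,2) by (auto simp: lie_hom_def module_hom_def compose_def L.bracket_closed Pi_iff)
qed

lemma id_lie_hom: "lie_algebra K L \<Longrightarrow> (\<lambda>x\<in>carrier L. x) \<in> lie_hom K L L"
proof -
  assume "lie_algebra K L"
  then interpret L: lie_algebra K L .
  show ?thesis
    using id_module_hom[OF L.module_axioms] by (simp add: lie_hom_def L.bracket_closed)
qed

section \<open>The categories of classical and of constraint Lie-Rinehart algebras\<close>

lemma lie_rinehart_hom_iff:
  "(\<phi>, \<Phi>) \<in> lie_rinehart_hom K X Y \<longleftrightarrow>
    \<phi> \<in> algebra_hom K (lr_alg X) (lr_alg Y) \<and> \<phi> \<in> extensional (carrier (lr_alg X)) \<and>
    \<Phi> \<in> lie_hom K (restrict_scalars (lr_alg X) (lr_lie X)) (restrict_scalars (lr_alg Y) (lr_lie Y)) \<and>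
    \<Phi> \<in> extensional (carrier (lr_lie X)) \<and>
    (\<forall>a\<in>carrier (lr_alg X). \<forall>\<xi>\<in>carrier (lr_lie X).
       \<Phi> (a \<odot>\<^bsub>lr_lie X\<^esub> \<xi>) = \<phi> a \<odot>\<^bsub>lr_lie Y\<^esub> \<Phi> \<xi>) \<and>
    (\<forall>a\<in>carrier (lr_alg X). \<forall>\<xi>\<in>carrier (lr_lie X).
       lr_anchor Y (\<Phi> \<xi>) (\<phi> a) = \<phi> (lr_anchor X \<xi> a))"
  by (auto simp: lie_rinehart_hom_def)

text \<open>Forgets the N- and 0-components. A constraint morphism is then a classical morphism of
  the T-parts that respects components, so identities and composites are inherited from the
  classical case.\<close>

definition total_lie_rinehart ::
  "('k, 'a, 'g) constraint_lie_rinehart_data \<Rightarrow> ('k, 'a, 'g) lie_rinehart_data"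
  where "total_lie_rinehart X =
    \<lparr>lr_alg = comp_T (clr_alg X), lr_lie = comp_T (clr_lie X), lr_anchor = clr_anchor X\<rparr>"

lemma total_lie_rinehart_simps [simp]:
  "lr_alg (total_lie_rinehart X) = comp_T (clr_alg X)"
  "lr_lie (total_lie_rinehart X) = comp_T (clr_lie X)"
  "lr_anchor (total_lie_rinehart X) = clr_anchor X"
  by (simp_all add: total_lie_rinehart_def)

lemma constraint_lie_rinehart_hom_iff:
  "(\<phi>, \<Phi>) \<in> constraint_lie_rinehart_hom K X Y \<longleftrightarrow>
    (\<phi>, \<Phi>) \<in> lie_rinehart_hom K (total_lie_rinehart X) (total_lie_rinehart Y) \<and>
    \<phi> \<in> constraint_maps (clr_alg X) (clr_alg Y) \<and> \<Phi> \<in> constraint_maps (clr_lie X) (clr_lie Y)"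
  by (auto simp: constraint_lie_rinehart_hom_def lie_rinehart_hom_iff constraint_algebra_hom_def
    constraint_lie_hom_def constraint_maps_def)

lemma lie_rinehart_hom_carrier:
  assumes "(\<phi>, \<Phi>) \<in> lie_rinehart_hom K X Y"
  shows "\<phi> \<in> carrier (lr_alg X) \<rightarrow> carrier (lr_alg Y)"
    and "\<Phi> \<in> carrier (lr_lie X) \<rightarrow> carrier (lr_lie Y)"
    and "\<phi> \<in> extensional (carrier (lr_alg X))"
    and "\<Phi> \<in> extensional (carrier (lr_lie X))"
  using assms by (simp_all add: lie_rinehart_hom_iff algebra_hom_def lie_hom_def module_hom_def)

text \<open>Identities and composites are cut off outside the carrier; their anchor condition can be
  evaluated only where the anchor stays inside it.\<close>

lemma (in lie_rinehart) anchor_closed: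
  "\<lbrakk>a \<in> carrier (lr_alg X); \<xi> \<in> carrier (lr_lie X)\<rbrakk> \<Longrightarrow> lr_anchor X \<xi> a \<in> carrier (lr_alg X)"
  using anchor_module_hom by (auto simp: module_hom_def dest: DerE(2))

lemma id_lie_rinehart_hom:
  assumes "lie_rinehart K X"
  shows "(\<lambda>a\<in>carrier (lr_alg X). a, \<lambda>\<xi>\<in>carrier (lr_lie X). \<xi>) \<in> lie_rinehart_hom K X X"
proof -
  interpret X: lie_rinehart K X by fact
  show ?thesis
    using id_algebra_hom[OF X.alg] id_lie_hom[OF X.lie] X.anchor_closed module.smult_closed[OF X.mod]
    by (simp add: lie_rinehart_hom_iff)
qed

lemma compose_lie_rinehart_hom:
  assumes "lie_rinehart K X" and f: "(\<phi>, \<Phi>) \<in> lie_rinehart_hom K X Y"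
    and g: "(\<psi>, \<Psi>) \<in> lie_rinehart_hom K Y Z"
  shows "(compose (carrier (lr_alg X)) \<psi> \<phi>, compose (carrier (lr_lie X)) \<Psi> \<Phi>)
    \<in> lie_rinehart_hom K X Z"
proof -
  interpret X: lie_rinehart K X by fact
  note carrier = funcset_mem[OF lie_rinehart_hom_carrier(1)[OF f]]
    funcset_mem[OF lie_rinehart_hom_carrier(2)[OF f]]
  note closed = X.anchor_closed module.smult_closed[OF X.mod]
  have "compose (carrier (lr_alg X)) \<psi> \<phi> \<in> algebra_hom K (lr_alg X) (lr_alg Z)"
    using f g by (auto simp: lie_rinehart_hom_iff intro: compose_algebra_hom X.alg)
  \<comment> \<open>Restriction of scalars keeps the carrier, so the cut-off of the composite is the
    same for both module structures.\<close>
  moreover have "compose (carrier (lr_lie X)) \<Psi> \<Phi> \<in> lie_hom K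
      (restrict_scalars (lr_alg X) (lr_lie X)) (restrict_scalars (lr_alg Z) (lr_lie Z))"
    using f g
    by (auto simp: lie_rinehart_hom_iff
      intro: compose_lie_hom[OF _ _ X.lie, simplified restrict_scalars_simps])
  ultimately show ?thesis
    using f g carrier closed by (simp add: lie_rinehart_hom_iff compose_eq)
qed

lemma (in constraint_lie_rinehart) lie_rinehart_T:
  "lie_rinehart K (total_lie_rinehart X)"
  using A.T_algebra T_module lie_algebra_T anchor_lie_hom anchor_module_hom leibniz
  by (intro lie_rinehart.intro) (simp_all add: constraint_lie_hom_def constraint_module_hom_def)

text \<open>The unit laws are equalities of functions and rely on extensional morphisms.
  Associativity needs the first morphism to map into the carrier where the next composite is
  defined.\<close>

lemma category_LieRinehart: "category (LieRinehart_cat K)"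
proof (unfold_locales, goal_cases)
  case (1 X)
  then show ?case by (simp add: LieRinehart_cat_def id_lie_rinehart_hom)
next
  case (2 X Y Z f g)
  then show ?case by (cases f; cases g)
    (simp add: LieRinehart_cat_def compose_lie_rinehart_hom)
next
  case (3 X Y f)
  obtain \<phi> \<Phi> where f: "f = (\<phi>, \<Phi>)"
    by fastforce
  note carrier = lie_rinehart_hom_carrier[of \<phi> \<Phi> K X Y]
  show ?case
    using 3
    by (simp add: LieRinehart_cat_def f compose_Id[OF carrier(1,3)] compose_Id[OF carrier(2,4)])
next
  case (4 X Y f)
  obtain \<phi> \<Phi> where f: "f = (\<phi>, \<Phi>)"
    by fastforce
  note carrier = lie_rinehart_hom_carrier[of \<phi> \<Phi> K X Y]
  show ?case
    using 4
    by (simp add: LieRinehart_cat_def f Id_compose[OF carrier(1,3)] Id_compose[OF carrier(2,4)])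
next
  case (5 W X Y Z f g h)
  obtain \<phi> \<Phi> where f: "f = (\<phi>, \<Phi>)"
    by fastforce
  obtain \<phi>' \<Phi>' where g: "g = (\<phi>', \<Phi>')"
    by fastforce
  obtain \<phi>'' \<Phi>'' where h: "h = (\<phi>'', \<Phi>'')"
    by fastforce
  note carrier = lie_rinehart_hom_carrier[of \<phi> \<Phi> K W X]
  show ?case
    using 5
    by (simp add: LieRinehart_cat_def f g h compose_assoc[OF carrier(1)] compose_assoc[OF carrier(2)])
qed

lemma id_constraint_lie_rinehart_hom:
  assumes "constraint_lie_rinehart K X"
  shows "(\<lambda>a\<in>carrier (comp_T (clr_alg X)). a, \<lambda>\<xi>\<in>carrier (comp_T (clr_lie X)). \<xi>)
    \<in> constraint_lie_rinehart_hom K X X"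
proof -
  interpret X: constraint_lie_rinehart K X by fact
  show ?thesis
    using id_lie_rinehart_hom[OF X.lie_rinehart_T]
    by (auto simp: constraint_lie_rinehart_hom_iff constraint_maps_def)
qed

text \<open>Both components lie in the carrier of \<open>comp_T C\<close>, where the cut-off
  \<open>compose\<close> is ordinary composition.\<close>

lemma compose_constraint_maps:
  assumes "constraint_group C" "f \<in> constraint_maps C D" "g \<in> constraint_maps D E"
  shows "compose (carrier (comp_T C)) g f \<in> constraint_maps C E"
proof -
  interpret C: constraint_group C by fact
  show ?thesis
    using assms(2,3) by (auto simp: constraint_maps_def compose_eq image_subset_iff)
qed

lemma compose_constraint_lie_rinehart_hom:
  assumes "constraint_lie_rinehart K X"
    and "(\<phi>, \<Phi>) \<in> constraint_lie_rinehart_hom K X Y"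
    and "(\<psi>, \<Psi>) \<in> constraint_lie_rinehart_hom K Y Z"
  shows "(compose (carrier (comp_T (clr_alg X))) \<psi> \<phi>, compose (carrier (comp_T (clr_lie X))) \<Psi> \<Phi>)
    \<in> constraint_lie_rinehart_hom K X Z"
proof -
  interpret X: constraint_lie_rinehart K X by fact
  show ?thesis
    using assms compose_lie_rinehart_hom[OF X.lie_rinehart_T, of \<phi> \<Phi> _ \<psi> \<Psi>]
    by (auto simp: constraint_lie_rinehart_hom_iff
      intro: compose_constraint_maps X.constraint_group_axioms X.A.constraint_group_axioms)
qed

lemma constraint_lie_rinehart_hom_carrier:
  assumes "(\<phi>, \<Phi>) \<in> constraint_lie_rinehart_hom K X Y"
  shows "\<phi> \<in> carrier (comp_T (clr_alg X)) \<rightarrow> carrier (comp_T (clr_alg Y))"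
    and "\<Phi> \<in> carrier (comp_T (clr_lie X)) \<rightarrow> carrier (comp_T (clr_lie Y))"
    and "\<phi> \<in> extensional (carrier (comp_T (clr_alg X)))"
    and "\<Phi> \<in> extensional (carrier (comp_T (clr_lie X)))"
proof -
  have "(\<phi>, \<Phi>) \<in> lie_rinehart_hom K (total_lie_rinehart X) (total_lie_rinehart Y)"
    using assms by (simp add: constraint_lie_rinehart_hom_iff)
  note carrier = lie_rinehart_hom_carrier[OF this, simplified]
  show "\<phi> \<in> carrier (comp_T (clr_alg X)) \<rightarrow> carrier (comp_T (clr_alg Y))"
    and "\<Phi> \<in> carrier (comp_T (clr_lie X)) \<rightarrow> carrier (comp_T (clr_lie Y))"
    and "\<phi> \<in> extensional (carrier (comp_T (clr_alg X)))"
    and "\<Phi> \<in> extensional (carrier (comp_T (clr_lie X)))"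
    by (fact carrier)+
qed

lemma category_CLieRinehart: "category (CLieRinehart_cat K)"
proof (unfold_locales, goal_cases)
  case (1 X)
  then show ?case by (simp add: CLieRinehart_cat_def id_constraint_lie_rinehart_hom)
next
  case (2 X Y Z f g)
  then show ?case by (cases f; cases g)
    (simp add: CLieRinehart_cat_def compose_constraint_lie_rinehart_hom)
next
  case (3 X Y f)
  obtain \<phi> \<Phi> where f: "f = (\<phi>, \<Phi>)"
    by fastforce
  note carrier = constraint_lie_rinehart_hom_carrier[of \<phi> \<Phi> K X Y]
  show ?case
    using 3
    by (simp add: CLieRinehart_cat_def f compose_Id[OF carrier(1,3)] compose_Id[OF carrier(2,4)])
next
  case (4 X Y f)
  obtain \<phi> \<Phi> where f: "f = (\<phi>, \<Phi>)"
    by fastforce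
  note carrier = constraint_lie_rinehart_hom_carrier[of \<phi> \<Phi> K X Y]
  show ?case
    using 4
    by (simp add: CLieRinehart_cat_def f Id_compose[OF carrier(1,3)] Id_compose[OF carrier(2,4)])
next
  case (5 W X Y Z f g h)
  obtain \<phi> \<Phi> where f: "f = (\<phi>, \<Phi>)"
    by fastforce
  obtain \<phi>' \<Phi>' where g: "g = (\<phi>', \<Phi>')"
    by fastforce
  obtain \<phi>'' \<Phi>'' where h: "h = (\<phi>'', \<Phi>'')"
    by fastforce
  note carrier = constraint_lie_rinehart_hom_carrier[of \<phi> \<Phi> K W X]
  show ?case
    using 5
    by (simp add: CLieRinehart_cat_def f g h compose_assoc[OF carrier(1)] compose_assoc[OF carrier(2)])
qed

section \<open>Functoriality of the reduction\<close>

lemma red_lie_rinehart_hom_id: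
  assumes "constraint_lie_rinehart K X"
  shows "red_lie_rinehart_hom X X (Ident (CLieRinehart_cat K) X)
    = Ident (LieRinehart_cat K) (red_lie_rinehart K X)"
proof -
  interpret X: constraint_lie_rinehart K X by fact
  note residue = red_map_residue_hom[OF assms assms id_constraint_lie_rinehart_hom[OF assms]]
  have "red_map X.A X.A (\<lambda>a\<in>carrier (comp_T X.A). a) = (\<lambda>P\<in>red_carrier X.A. P)"
    by (rule X.A.red_map_eqI) (simp_all add: residue(1))
  moreover have "red_map X.G X.G (\<lambda>\<xi>\<in>carrier (comp_T X.G). \<xi>) = (\<lambda>P\<in>red_carrier X.G. P)"
    by (rule X.red_map_eqI) (simp_all add: residue(2))
  ultimately show ?thesis
    by (simp add: red_lie_rinehart_hom_def CLieRinehart_cat_def LieRinehart_cat_def)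
qed

lemma red_lie_rinehart_hom_compose:
  assumes X: "constraint_lie_rinehart K X" and Y: "constraint_lie_rinehart K Y"
    and Z: "constraint_lie_rinehart K Z"
    and f: "(\<phi>, \<Phi>) \<in> constraint_lie_rinehart_hom K X Y"
    and g: "(\<psi>, \<Psi>) \<in> constraint_lie_rinehart_hom K Y Z"
  shows "red_lie_rinehart_hom X Z (Comp (CLieRinehart_cat K) X Y Z (\<psi>, \<Psi>) (\<phi>, \<Phi>))
    = Comp (LieRinehart_cat K) (red_lie_rinehart K X) (red_lie_rinehart K Y) (red_lie_rinehart K Z)
        (red_lie_rinehart_hom Y Z (\<psi>, \<Psi>)) (red_lie_rinehart_hom X Y (\<phi>, \<Phi>))"
proof -
  interpret X: constraint_lie_rinehart K X by fact
  interpret Y: constraint_lie_rinehart K Y by fact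
  \<comment> \<open>Evaluation on classes for the two morphisms and for their composite, which is
    itself a constraint morphism. Odd entries concern the algebra component, even entries the Lie
    component.\<close>
  note residue = red_map_residue_hom[OF X Y f] red_map_residue_hom[OF Y Z g]
    red_map_residue_hom[OF X Z compose_constraint_lie_rinehart_hom[OF X f g]]
  \<comment> \<open>Images of N-elements are N-elements, so the second reduced map can be evaluated
    on the class produced by the first.\<close>
  note N = constraint_lie_rinehart_homD(3,6)[OF f]
  have "red_map X.A (clr_alg Z) (compose (carrier (comp_T X.A)) \<psi> \<phi>)
      = compose (red_carrier X.A) (red_map Y.A (clr_alg Z) \<psi>) (red_map X.A Y.A \<phi>)"
    by (rule X.A.red_map_eqI) (simp_all add: residue(1,3,5) N compose_eq)
  moreover have "red_map X.G (clr_lie Z) (compose (carrier (comp_T X.G)) \<Psi> \<Phi>)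
      = compose (red_carrier X.G) (red_map Y.G (clr_lie Z) \<Psi>) (red_map X.G Y.G \<Phi>)"
    by (rule X.red_map_eqI) (simp_all add: residue(2,4,6) N compose_eq)
  ultimately show ?thesis
    by (simp add: red_lie_rinehart_hom_def CLieRinehart_cat_def LieRinehart_cat_def)
qed

theorem theorem4p4:
  fixes K :: "('k, 'm) ring_scheme"
    and AG :: "('k, 'a, 'g) constraint_lie_rinehart_data"
    and BH :: "('k, 'b, 'h) constraint_lie_rinehart_data"
  assumes "field K"
    and "constraint_lie_rinehart K AG"
    and "constraint_lie_rinehart K BH"
  shows "lie_rinehart K (red_lie_rinehart K AG) \<and>
    (\<forall>\<phi> \<Phi>. (\<phi>, \<Phi>) \<in> constraint_lie_rinehart_hom K AG BH \<longrightarrow>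
       red_lie_rinehart_hom AG BH (\<phi>, \<Phi>)
         \<in> lie_rinehart_hom K (red_lie_rinehart K AG) (red_lie_rinehart K BH)) \<and>
    category_functor
      (CLieRinehart_cat K ::
        (('k, 'c, 'l) constraint_lie_rinehart_data, ('c \<Rightarrow> 'c) \<times> ('l \<Rightarrow> 'l)) category)
      (LieRinehart_cat K ::
        (('k, 'c set, 'l set) lie_rinehart_data,
         ('c set \<Rightarrow> 'c set) \<times> ('l set \<Rightarrow> 'l set)) category)
      (red_lie_rinehart K) red_lie_rinehart_hom"
proof (intro conjI allI impI)
  show "lie_rinehart K (red_lie_rinehart K AG)"
    by (rule constraint_lie_rinehart.lie_rinehart_red) fact
  show "red_lie_rinehart_hom AG BH (\<phi>, \<Phi>)
      \<in> lie_rinehart_hom K (red_lie_rinehart K AG) (red_lie_rinehart K BH)"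
    if "(\<phi>, \<Phi>) \<in> constraint_lie_rinehart_hom K AG BH" for \<phi> \<Phi>
    using assms(2,3) that by (rule red_lie_rinehart_hom_in_hom)
  \<comment> \<open>Reduced objects consist of cosets, so the functor leads from the universe
    \<open>'c\<close>, \<open>'l\<close> to the universe \<open>'c set\<close>,
    \<open>'l set\<close>.\<close>
  show "category_functor
      (CLieRinehart_cat K ::
        (('k, 'c, 'l) constraint_lie_rinehart_data, ('c \<Rightarrow> 'c) \<times> ('l \<Rightarrow> 'l)) category)
      (LieRinehart_cat K ::
        (('k, 'c set, 'l set) lie_rinehart_data,
         ('c set \<Rightarrow> 'c set) \<times> ('l set \<Rightarrow> 'l set)) category)
      (red_lie_rinehart K) red_lie_rinehart_hom"
    (is "category_functor ?C ?D _ _")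
  proof (intro category_functor.intro category_functor_axioms.intro
      category_CLieRinehart category_LieRinehart)
    have Obj: "X \<in> Obj ?C \<longleftrightarrow> constraint_lie_rinehart K X"
      "X' \<in> Obj ?D \<longleftrightarrow> lie_rinehart K X'" for X X'
      by (simp_all add: CLieRinehart_cat_def LieRinehart_cat_def)
    have Hom: "Hom ?C X Y = constraint_lie_rinehart_hom K X Y"
      "Hom ?D X' Y' = lie_rinehart_hom K X' Y'" for X Y X' Y'
      by (simp_all add: CLieRinehart_cat_def LieRinehart_cat_def)
    fix X Y Z assume X: "X \<in> Obj ?C"
    then show "red_lie_rinehart K X \<in> Obj ?D"
      by (simp add: Obj constraint_lie_rinehart.lie_rinehart_red)
    show "red_lie_rinehart_hom X X (Ident ?C X) = Ident ?D (red_lie_rinehart K X)"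
      using X by (simp add: Obj red_lie_rinehart_hom_id)
    fix f assume Y: "Y \<in> Obj ?C" and f: "f \<in> Hom ?C X Y"
    then show "red_lie_rinehart_hom X Y f \<in> Hom ?D (red_lie_rinehart K X) (red_lie_rinehart K Y)"
      using X by (cases f) (simp add: Obj Hom red_lie_rinehart_hom_in_hom)
    fix g assume "Z \<in> Obj ?C" "g \<in> Hom ?C Y Z"
    then show "red_lie_rinehart_hom X Z (Comp ?C X Y Z g f) =
        Comp ?D (red_lie_rinehart K X) (red_lie_rinehart K Y) (red_lie_rinehart K Z)
          (red_lie_rinehart_hom Y Z g) (red_lie_rinehart_hom X Y f)"
      using X Y f by (cases f; cases g)
    (simp add: Obj Hom red_lie_rinehart_hom_compose)
  qed
qed

end
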